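(* For every integer $m\ge 2$ there exists $\alpha\in K^{(2)}$ such that $\mathrm{Hw}(\alpha)=q^{-m}$.
   Context: Let $q$ be a positive power of a prime, $R=\mathbb F_q[Y]$, $K=\mathbb F_q(Y)$, $\widehat K=\mathbb F_q((Y^{-1}))$ with absolute value $|P/Q|=q^{\deg P-\deg Q}$ extended to $\widehat K$. Let $K^{(2)}=\{f\in\widehat K:[K(f):K]=2\}$; for $\alpha\in K^{(2)}$, $\alpha^\sigma$ is its Galois conjugate over $K$, and $\Theta_\alpha=\mathrm{PGL}_2(R)\cdot\{\alpha,\alpha^\sigma\}$ (projective action by homographies on $\widehat K\cup\{\infty\}$). For $f\in\widehat K\setminus(K\cup\Theta_\alpha)$, $c_\alpha(f)=\liminf_{\beta\in\Theta_\alpha,\ |\beta-\beta^\sigma|\to0}\frac{|f-\beta|}{|\beta-\beta^\sigma|}$, and $\mathrm{Sp}(\alpha)=\{c_\alpha(f): f\in\widehat K\setminus(K\cup\Theta_\alpha)\}$. The quadratic Hurwitz constant is $\mathrm{Hw}(\alpha)=\max \mathrm{Sp}(\alpha)$ (this maximum exists and lies in $q^{\mathbb Z}$). *)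

theory Defs
  imports "HOL-Computational_Algebra.Formal_Laurent_Series" "HOL-Library.Extended_Real" "HOL-Library.Cardinality"
begin

text \<open>Model: the finite field F_q is a type 'a of class {field, finite}, q = CARD('a).
  The completion F_q((Y^-1)) is modelled as 'a fls (Laurent series in X), via X = Y^-1.
  Thus Y corresponds to fls_X_inv.\<close>

text \<open>R = F_q[Y]: Laurent series in X with no positive powers of X (finitely many
  negative powers is automatic for fls).\<close>
definition Rpoly :: "('a::{field,finite}) fls set" where
  "Rpoly = {f. \<forall>n>0. fls_nth f n = 0}"

definition Kfield :: "('a::{field,finite}) fls set" where
  "Kfield = {P / Q | P Q. P \<in> Rpoly \<and> Q \<in> Rpoly \<and> Q \<noteq> 0}"

text \<open>Absolute value |f| = q^(degree in Y) = q^(- X-adic valuation), |0| = 0.\<close>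
definition habs :: "('a::{field,finite}) fls \<Rightarrow> real" where
  "habs f = (if f = 0 then 0 else real CARD('a) powi (- fls_subdegree f))"

text \<open>K^(2): elements f with [K(f):K] = 2, i.e. f not in K and f is a root of a
  nonzero quadratic polynomial over R (equivalently over K).\<close>
definition Kquad :: "('a::{field,finite}) fls set" where
  "Kquad = {f. f \<notin> Kfield \<and>
     (\<exists>a b c. a \<in> Rpoly \<and> b \<in> Rpoly \<and> c \<in> Rpoly \<and> a \<noteq> 0 \<and> a * f^2 + b * f + c = 0)}"

text \<open>Galois conjugate of a quadratic irrational: the other root -b/a - f of its
  minimal polynomial a X^2 + b X + c over K.\<close>
definition qconj :: "('a::{field,finite}) fls \<Rightarrow> 'a fls" where
  "qconj f = (THE g. \<exists>a b c. a \<in> Rpoly \<and> b \<in> Rpoly \<and> c \<in> Rpoly \<and> a \<noteq> 0 \<and>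
                 a * f^2 + b * f + c = 0 \<and> g = - b / a - f)"

text \<open>Elements of PGL_2(R), represented by matrices [[a,b],[c,d]] over R with
  determinant a nonzero constant (a unit of R).\<close>
definition pgl2R :: "('a::{field,finite}) fls \<Rightarrow> 'a fls \<Rightarrow> 'a fls \<Rightarrow> 'a fls \<Rightarrow> bool" where
  "pgl2R a b c d \<longleftrightarrow> a \<in> Rpoly \<and> b \<in> Rpoly \<and> c \<in> Rpoly \<and> d \<in> Rpoly \<and>
     (\<exists>u. u \<noteq> 0 \<and> a * d - b * c = fls_const u)"

text \<open>Homography x |-> (a x + b)/(c x + d). On points outside K (the only ones used)
  the denominator never vanishes, so infinity does not occur.\<close>
definition homog :: "('a::{field,finite}) fls \<Rightarrow> 'a fls \<Rightarrow> 'a fls \<Rightarrow> 'a fls \<Rightarrow> 'a fls \<Rightarrow> 'a fls" where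
  "homog a b c d x = (a * x + b) / (c * x + d)"

definition Theta :: "('a::{field,finite}) fls \<Rightarrow> 'a fls set" where
  "Theta \<alpha> = {homog a b c d \<gamma> | a b c d \<gamma>. pgl2R a b c d \<and> \<gamma> \<in> {\<alpha>, qconj \<alpha>}}"

text \<open>c_alpha(f) = liminf over beta in Theta_alpha, as |beta - beta^sigma| -> 0, of
  |f - beta| / |beta - beta^sigma| (an extended real).\<close>
definition calpha :: "('a::{field,finite}) fls \<Rightarrow> 'a fls \<Rightarrow> ereal" where
  "calpha \<alpha> f = (SUP \<epsilon>\<in>{0::real<..}.
      INF \<beta>\<in>{\<beta> \<in> Theta \<alpha>. habs (\<beta> - qconj \<beta>) < \<epsilon>}.
        ereal (habs (f - \<beta>) / habs (\<beta> - qconj \<beta>)))"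

definition Sp :: "('a::{field,finite}) fls \<Rightarrow> ereal set" where
  "Sp \<alpha> = {calpha \<alpha> f | f. f \<notin> Kfield \<and> f \<notin> Theta \<alpha>}"

end

theory Submission
  imports Defs
begin

text \<open>Choose a periodic bi-infinite sequence \<open>b\<close> of non-constant polynomials in which any two
  consecutive degrees add up to at most \<open>m\<close> and in which every word of length \<open>m + 1\<close> with this
  property occurs, and let \<open>\<alpha> = [b\<^sub>0; b\<^sub>1, \<dots>]\<close>; its conjugate is \<open>-[0; b\<^sub>-\<^sub>1, b\<^sub>-\<^sub>2, \<dots>]\<close>.

  Upper bound: let \<open>f = [a\<^sub>0; a\<^sub>1, \<dots>]\<close> be arbitrary. Either two consecutive degrees of partial quotients of \<open>f\<close>
  have sum at least \<open>m\<close> infinitely often, and then a pair of degrees \<open>k, m - k\<close> occurring in \<open>b\<close> fits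
  inside them, or the tail of \<open>f\<close> is made of words occurring in \<open>b\<close>. In both cases the convergent
  matrices of \<open>f\<close> move shifts of \<open>\<alpha>\<close> to elements \<open>\<beta>\<close> with
  \<open>|f - \<beta>| \<le> q\<^bsup>-m\<^esup> |\<beta> - \<beta>\<^sup>\<sigma>|\<close>.

  Lower bound: take all partial quotients of \<open>f\<close> of degree \<open>m + 1\<close>. The normalised values
  \<open>|p - q\<beta>| |p - q\<beta>\<^sup>\<sigma>| / |\<beta> - \<beta>\<^sup>\<sigma>|\<close> are permuted by \<open>PGL\<^sub>2(R)\<close>, and a reduction argument shows
  that each of them, and each product of two of them at the columns of a matrix in \<open>GL\<^sub>2(R)\<close>, is at
  least \<open>q\<^bsup>-m\<^esup>\<close>. If \<open>|f - \<beta>| < q\<^bsup>-m\<^esup> |\<beta> - \<beta>\<^sup>\<sigma>|\<close>, one or two consecutive convergents of \<open>f\<close>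
  violate this.\<close>

section \<open>The absolute value and polynomials\<close>

lemma card_field_gt_1: "real CARD('a::{field,finite}) > 1"
proof -
  have "card {0, 1::'a} \<le> CARD('a)" by (rule card_mono) auto
  thus ?thesis by simp
qed

lemma card_powi_le_iff:
  "real CARD('a::{field,finite}) powi i \<le> real CARD('a) powi j \<longleftrightarrow> i \<le> j"
  using power_int_increasing[of i j "real CARD('a)"] card_field_gt_1[where 'a='a]
    power_int_strict_increasing[of j i "real CARD('a)"]
  by (metis less_eq_real_def not_le)

lemma habs_0 [simp]: "habs 0 = 0"
  by (simp add: habs_def)

lemma habs_nonneg [simp]: "habs f \<ge> 0"
  by (simp add: habs_def)

lemma habs_eq_0_iff [simp]: "habs (f::'a::{field,finite} fls) = 0 \<longleftrightarrow> f = 0"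
  by (simp add: habs_def)

lemma habs_pos_iff [simp]: "habs (f::'a::{field,finite} fls) > 0 \<longleftrightarrow> f \<noteq> 0"
  using habs_nonneg[of f] habs_eq_0_iff[of f] by linarith

lemma habs_const [simp]: "u \<noteq> 0 \<Longrightarrow> habs (fls_const (u::'a::{field,finite})) = 1"
  by (simp add: habs_def)

lemma habs_1 [simp]: "habs (1::'a::{field,finite} fls) = 1"
  by (simp add: habs_def)

lemma habs_mult [simp]: "habs (f * g) = habs f * habs (g::'a::{field,finite} fls)"
  by (simp add: habs_def flip: power_int_add)

lemma habs_inverse [simp]: "habs (inverse f) = inverse (habs (f::'a::{field,finite} fls))"
proof (cases "f = 0")
  case False
  hence "habs (inverse f) * habs f = 1" by (simp flip: habs_mult)
  thus ?thesis using False by (simp add: field_simps)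
qed auto

lemma habs_divide [simp]: "habs (f / g) = habs f / habs (g::'a::{field,finite} fls)"
  by (simp add: divide_inverse)

lemma habs_power [simp]: "habs (f ^ n) = habs (f::'a::{field,finite} fls) ^ n"
  by (induction n) auto

lemma habs_minus [simp]: "habs (- f) = habs (f::'a::{field,finite} fls)"
  by (simp add: habs_def)

lemma habs_minus_commute: "habs (f - g) = habs (g - f::'a::{field,finite} fls)"
  using habs_minus[of "f - g"] by simp

lemma habs_le_powi_iff:
  "habs (f::'a::{field,finite} fls) \<le> real CARD('a) powi (- n) \<longleftrightarrow> (\<forall>k<n. fls_nth f k = 0)"
proof (cases "f = 0")
  case False
  have "habs f \<le> real CARD('a) powi (- n) \<longleftrightarrow> n \<le> fls_subdegree f"
    using False by (simp add: habs_def card_powi_le_iff)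
  also have "\<dots> \<longleftrightarrow> (\<forall>k<n. fls_nth f k = 0)"
    using False fls_subdegree_geI[of f n] by auto
  finally show ?thesis .
qed auto

text \<open>The valuation is discrete: nonzero values are integral powers of q, so a strict bound by
  one power improves to the next smaller one.\<close>

lemma habs_less_powi_imp:
  assumes "habs (f::'a::{field,finite} fls) < real CARD('a) powi (k + 1)"
  shows "habs f \<le> real CARD('a) powi k"
proof (cases "f = 0")
  case False
  hence "\<not> k + 1 \<le> - fls_subdegree f"
    using assms by (simp add: habs_def card_powi_le_iff flip: not_le)
  thus ?thesis using False by (simp add: habs_def card_powi_le_iff)
qed auto

lemma habs_less_power_Suc:
  assumes "habs (f::'a::{field,finite} fls) < real CARD('a) ^ Suc d"
  shows "habs f \<le> real CARD('a) ^ d"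
  using habs_less_powi_imp[of f "int d"] assms
  by (metis of_nat_Suc power_int_of_nat add.commute)

lemma habs_less_1_imp: "habs (f::'a::{field,finite} fls) < 1 \<Longrightarrow> habs f \<le> 1 / real CARD('a)"
  using habs_less_powi_imp[of f "-1"] by (simp add: power_int_minus divide_inverse)

lemma habs_gt_1_imp: "habs (f::'a::{field,finite} fls) > 1 \<Longrightarrow> habs f \<ge> real CARD('a)"
proof -
  assume f: "habs f > 1"
  hence "f \<noteq> 0" by auto
  moreover have "habs (inverse f) \<le> 1 / real CARD('a)"
    using f \<open>f \<noteq> 0\<close> by (intro habs_less_1_imp) (simp add: divide_less_eq_1 inverse_eq_divide)
  moreover have "real CARD('a) > 0" by simp
  ultimately show ?thesis by (simp add: field_simps)
qed

lemma habs_add_le: "habs (f + g) \<le> max (habs f) (habs (g::'a::{field,finite} fls))"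
proof (cases "f = 0 \<or> g = 0 \<or> f + g = 0")
  case False
  hence "fls_subdegree (f + g) \<ge> min (fls_subdegree f) (fls_subdegree g)"
    by (auto intro!: fls_subdegree_geI)
  thus ?thesis using False by (auto simp: habs_def le_max_iff_disj card_powi_le_iff)
qed (auto simp: le_max_iff_disj)

lemma habs_diff_le: "habs (f - g) \<le> max (habs f) (habs (g::'a::{field,finite} fls))"
  using habs_add_le[of f "- g"] by simp

lemma habs_add_less: "habs f < c \<Longrightarrow> habs g < c \<Longrightarrow> habs (f + g::'a::{field,finite} fls) < c"
  using habs_add_le[of f g] by auto

lemma habs_diff_less: "habs f < c \<Longrightarrow> habs g < c \<Longrightarrow> habs (f - g::'a::{field,finite} fls) < c"
  using habs_diff_le[of f g] by auto

lemma habs_add_eq_right: "habs f < habs g \<Longrightarrow> habs (f + g) = habs (g::'a::{field,finite} fls)"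
  using habs_add_le[of f g] habs_diff_le[of "f + g" f] by auto

lemma habs_add_eq_left: "habs g < habs f \<Longrightarrow> habs (f + g) = habs (f::'a::{field,finite} fls)"
  using habs_add_eq_right[of g f] by (simp add: add.commute)

lemma habs_diff_eq_right: "habs f < habs g \<Longrightarrow> habs (f - g) = habs (g::'a::{field,finite} fls)"
  using habs_add_eq_right[of f "- g"] by simp

lemma habs_diff_eq_left: "habs g < habs f \<Longrightarrow> habs (f - g) = habs (f::'a::{field,finite} fls)"
  using habs_add_eq_left[of "- g" f] by simp

lemma habs_diff_eq_max:
  "habs f \<noteq> habs g \<Longrightarrow> habs (f - g) = max (habs f) (habs (g::'a::{field,finite} fls))"
  using habs_diff_eq_left[of g f] habs_diff_eq_right[of f g] by fastforce

lemma habs_eq_if_close: "habs (f - g) < habs g \<Longrightarrow> habs f = habs (g::'a::{field,finite} fls)"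
  using habs_add_eq_right[of "f - g" g] by simp

section \<open>The polynomial ring inside the Laurent series, polynomial parts, completeness\<close>

lemma Rpoly_const [simp]: "fls_const c \<in> Rpoly"
  by (simp add: Rpoly_def)

lemma Rpoly_0 [simp]: "0 \<in> Rpoly" and Rpoly_1 [simp]: "1 \<in> Rpoly"
  using Rpoly_const[of 0] Rpoly_const[of 1] by simp_all

lemma Rpoly_add [intro]: "f \<in> Rpoly \<Longrightarrow> g \<in> Rpoly \<Longrightarrow> f + g \<in> Rpoly"
  and Rpoly_diff [intro]: "f \<in> Rpoly \<Longrightarrow> g \<in> Rpoly \<Longrightarrow> f - g \<in> Rpoly"
  and Rpoly_minus [intro]: "f \<in> Rpoly \<Longrightarrow> - f \<in> Rpoly"
  by (auto simp: Rpoly_def)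

lemma Rpoly_mult [intro]: "f \<in> Rpoly \<Longrightarrow> g \<in> Rpoly \<Longrightarrow> f * g \<in> Rpoly"
proof -
  assume fg: "f \<in> Rpoly" "g \<in> Rpoly"
  have "fls_nth f i * fls_nth g (n - i) = 0" if "n > 0" for n i
    using fg that by (cases "i > 0") (auto simp: Rpoly_def)
  hence "fls_nth (f * g) n = 0" if "n > 0" for n
    using that by (subst fls_times_nth(2)) (intro sum.neutral; simp)
  thus ?thesis by (simp add: Rpoly_def)
qed

lemma Rpoly_X_inv_power [simp]: "fls_X_inv ^ k \<in> Rpoly"
  by (auto simp: Rpoly_def)

lemma Rpoly_X_inv [simp]: "fls_X_inv \<in> Rpoly"
  using Rpoly_X_inv_power[of 1] by simp

lemma habs_X_inv [simp]: "habs (fls_X_inv :: 'a::{field,finite} fls) = real CARD('a)"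
  by (simp add: habs_def)

lemma habs_X_inv_power: "habs (fls_X_inv ^ k :: 'a::{field,finite} fls) = real CARD('a) ^ k"
  by simp

lemma Rpoly_habs_ge_1: "f \<in> Rpoly \<Longrightarrow> f \<noteq> 0 \<Longrightarrow> habs (f::'a::{field,finite} fls) \<ge> 1"
proof -
  assume f: "f \<in> Rpoly" "f \<noteq> 0"
  hence "\<not> fls_subdegree f > 0"
    using nth_fls_subdegree_nonzero[of f] by (auto simp: Rpoly_def)
  thus ?thesis using f card_field_gt_1[where 'a='a] by (simp add: habs_def one_le_power_int)
qed

lemma Rpoly_habs_less_1: "f \<in> Rpoly \<Longrightarrow> habs (f::'a::{field,finite} fls) < 1 \<Longrightarrow> f = 0"
  using Rpoly_habs_ge_1[of f] by force

lemma Rpoly_floor: "\<exists>a\<in>Rpoly. habs (f - a :: 'a::{field,finite} fls) < 1"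
proof
  \<comment> \<open>The subtracted series collects the terms of positive exponent in X = 1/Y, that
    is, the fractional part of \<open>f\<close>.\<close>
  define a where "a = f - fls_shift (-1) (fps_to_fls (Abs_fps (\<lambda>k. fls_nth f (int k + 1))))"
  show "a \<in> Rpoly" by (auto simp: a_def Rpoly_def)
  have "habs (f - a) \<le> real CARD('a) powi (- 1)"
    unfolding habs_le_powi_iff by (auto simp: a_def)
  also have "\<dots> < 1" using card_field_gt_1[where 'a='a] by (simp add: field_simps)
  finally show "habs (f - a) < 1" .
qed

text \<open>The rate of convergence freezes all coefficients of index at most n from stage n on, so
  the limit can be read off coefficientwise.\<close>

lemma fls_complete:
  fixes x :: "nat \<Rightarrow> 'a::{field,finite} fls"
  assumes x: "\<And>n. habs (x (Suc n) - x n) < 1 / real CARD('a) ^ n"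
  shows "\<exists>l. \<forall>n. habs (l - x n) < 1 / real CARD('a) ^ n"
proof -
  have step: "fls_nth (x (Suc n)) k = fls_nth (x n) k" if "k \<le> int n" for n k
  proof -
    have "habs (x (Suc n) - x n) < real CARD('a) powi (- int n - 1 + 1)"
      using x[of n] by (simp add: power_int_minus divide_inverse)
    from habs_less_powi_imp[OF this]
    have "habs (x (Suc n) - x n) \<le> real CARD('a) powi (- (int n + 1))" by simp
    hence "fls_nth (x (Suc n) - x n) k = 0" using that unfolding habs_le_powi_iff by auto
    thus ?thesis by simp
  qed
  have stable: "fls_nth (x (n + i)) k = fls_nth (x n) k" if "k \<le> int n" for n i k
    using that step by (induction i) auto
  \<comment> \<open>Coefficients of negative index are already final at stage 0, those of index k
    \<ge> 0 at stage k; hence a power series correction of \<open>x 0\<close> is enough.\<close>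
  define l where "l = x 0 + fps_to_fls (Abs_fps (\<lambda>k. fls_nth (x k - x 0) (int k)))"
  have l: "fls_nth l k = fls_nth (x n) k" if "k \<le> int n" for n k
  proof (cases "k < 0")
    case True
    thus ?thesis using stable[of k 0 n] by (simp add: l_def)
  next
    case False
    hence "fls_nth l k = fls_nth (x (nat k)) k" by (simp add: l_def)
    also have "\<dots> = fls_nth (x n) k" using stable[of k "nat k" "n - nat k"] that False by auto
    finally show ?thesis .
  qed
  have "habs (l - x n) < 1 / real CARD('a) ^ n" for n
  proof -
    have "habs (l - x n) \<le> real CARD('a) powi (- (int n + 1))"
      unfolding habs_le_powi_iff using l[of _ n] by auto
    also have "\<dots> < real CARD('a) powi (- int n)"
      using card_field_gt_1[where 'a='a] by (intro power_int_strict_increasing) auto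
    finally show ?thesis by (simp add: power_int_minus divide_inverse)
  qed
  thus ?thesis by blast
qed

section \<open>Homographies and Galois conjugation\<close>

lemma KfieldI: "P \<in> Rpoly \<Longrightarrow> Q \<in> Rpoly \<Longrightarrow> Q \<noteq> 0 \<Longrightarrow> f = P / Q \<Longrightarrow> f \<in> Kfield"
  by (auto simp: Kfield_def)

lemma KfieldE:
  assumes "f \<in> Kfield"
  obtains P Q where "P \<in> Rpoly" "Q \<in> Rpoly" "Q \<noteq> 0" "f = P / Q"
  using assms by (auto simp: Kfield_def)

lemma Kfield_Rpoly: "f \<in> Rpoly \<Longrightarrow> f \<in> Kfield"
  by (rule KfieldI[of f 1]) auto

lemma Kfield_add: "f \<in> Kfield \<Longrightarrow> g \<in> Kfield \<Longrightarrow> f + g \<in> Kfield"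
proof (elim KfieldE)
  fix P Q P' Q' :: "'a fls"
  assume "P \<in> Rpoly" "Q \<in> Rpoly" "Q \<noteq> 0" "f = P / Q" "P' \<in> Rpoly" "Q' \<in> Rpoly" "Q' \<noteq> 0" "g = P' / Q'"
  thus ?thesis by (intro KfieldI[of "P * Q' + P' * Q" "Q * Q'"]) (auto simp: field_simps)
qed

lemma Kfield_mult: "f \<in> Kfield \<Longrightarrow> g \<in> Kfield \<Longrightarrow> f * g \<in> Kfield"
proof (elim KfieldE)
  fix P Q P' Q' :: "'a fls"
  assume "P \<in> Rpoly" "Q \<in> Rpoly" "Q \<noteq> 0" "f = P / Q" "P' \<in> Rpoly" "Q' \<in> Rpoly" "Q' \<noteq> 0" "g = P' / Q'"
  thus ?thesis by (intro KfieldI[of "P * P'" "Q * Q'"]) auto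
qed

lemma Kfield_divide: "f \<in> Kfield \<Longrightarrow> g \<in> Kfield \<Longrightarrow> f / g \<in> Kfield"
proof (elim KfieldE)
  fix P Q P' Q' :: "'a fls"
  assume *: "P \<in> Rpoly" "Q \<in> Rpoly" "Q \<noteq> 0" "f = P / Q" "P' \<in> Rpoly" "Q' \<in> Rpoly" "Q' \<noteq> 0" "g = P' / Q'"
  show ?thesis
  proof (cases "P' = 0")
    case True
    thus ?thesis using * Kfield_Rpoly[of 0] by simp
  next
    case False
    thus ?thesis using * by (intro KfieldI[of "P * Q'" "Q * P'"]) auto
  qed
qed

lemma Kfield_diff: "f \<in> Kfield \<Longrightarrow> g \<in> Kfield \<Longrightarrow> f - g \<in> Kfield"
  using Kfield_add[of f "- 1 * g"] Kfield_mult[of "- 1" g] Kfield_Rpoly[of "- 1"]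
    Rpoly_minus[OF Rpoly_1] by auto

lemmas Kfield_intros = Kfield_add Kfield_mult Kfield_divide Kfield_diff

lemma linear_nonzero:
  assumes "x \<notin> Kfield" "c \<in> Rpoly" "d \<in> Rpoly" "c \<noteq> 0 \<or> d \<noteq> 0"
  shows "c * x + d \<noteq> 0"
proof
  assume 0: "c * x + d = 0"
  hence c: "c \<noteq> 0" using assms by auto
  hence "x = - d / c" using 0 by (simp add: field_simps eq_neg_iff_add_eq_0)
  thus False using assms c KfieldI[of "- d" c x] by auto
qed

lemma pgl2R_denominator:
  assumes "pgl2R a b c d" "x \<notin> Kfield"
  shows "c * x + d \<noteq> 0"
  using assms by (intro linear_nonzero) (auto simp: pgl2R_def)

lemma pgl2R_mult:
  assumes "pgl2R a b c d" "pgl2R a' b' c' d'"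
  shows "pgl2R (a * a' + b * c') (a * b' + b * d') (c * a' + d * c') (c * b' + d * d')"
proof -
  obtain u v where "u \<noteq> 0" "a * d - b * c = fls_const u" "v \<noteq> 0" "a' * d' - b' * c' = fls_const v"
    using assms by (auto simp: pgl2R_def)
  moreover have "(a * a' + b * c') * (c * b' + d * d') - (a * b' + b * d') * (c * a' + d * c')
      = (a * d - b * c) * (a' * d' - b' * c')"
    by (simp add: algebra_simps)
  ultimately show ?thesis
    using assms unfolding pgl2R_def by (auto intro!: exI[of _ "u * v"])
qed

lemma pgl2R_adjugate: "pgl2R a b c d \<Longrightarrow> pgl2R d (- b) (- c) a"
  by (auto simp: pgl2R_def mult.commute)

lemma homog_homog:
  assumes "pgl2R a' b' c' d'" "x \<notin> Kfield"
  shows "homog a b c d (homog a' b' c' d' x)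
    = homog (a * a' + b * c') (a * b' + b * d') (c * a' + d * c') (c * b' + d * d') x"
proof -
  define e where "e = c' * x + d'"
  have e: "e \<noteq> 0" unfolding e_def by (rule pgl2R_denominator[OF assms])
  have "a * ((a' * x + b') / e) + b = ((a * a' + b * c') * x + (a * b' + b * d')) / e"
    "c * ((a' * x + b') / e) + d = ((c * a' + d * c') * x + (c * b' + d * d')) / e"
    using e by (simp_all add: field_simps) (simp_all add: e_def algebra_simps)
  thus ?thesis using e by (simp add: homog_def flip: e_def)
qed

lemma homog_adjugate:
  assumes "pgl2R a b c d" "x \<notin> Kfield"
  shows "homog d (- b) (- c) a (homog a b c d x) = x"
proof -
  obtain u where "u \<noteq> 0" "a * d - b * c = fls_const u" using assms by (auto simp: pgl2R_def)
  hence nz: "a * d - b * c \<noteq> 0" by simp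
  have "homog d (- b) (- c) a (homog a b c d x) = ((a * d - b * c) * x) / (a * d - b * c)"
    unfolding homog_homog[OF assms] by (simp add: homog_def algebra_simps)
  thus ?thesis using nz by simp
qed

lemma homog_notin_Kfield:
  assumes "pgl2R a b c d" "x \<notin> Kfield"
  shows "homog a b c d x \<notin> Kfield"
proof
  assume "homog a b c d x \<in> Kfield"
  hence "homog d (- b) (- c) a (homog a b c d x) \<in> Kfield"
    unfolding homog_def[of d] using pgl2R_adjugate[OF assms(1)] Kfield_Rpoly
    by (intro Kfield_intros) (auto simp: pgl2R_def)
  thus False using assms by (simp add: homog_adjugate)
qed

text \<open>Trace and norm in K encode that \<open>x\<close> and \<open>y\<close> are the two roots
  of one quadratic over K. Unlike the definite description \<open>qconj\<close>, this is symmetric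
  and easy to transport by homographies.\<close>

definition Kconj :: "'a::{field,finite} fls \<Rightarrow> 'a fls \<Rightarrow> bool" where
  "Kconj x y \<longleftrightarrow> x \<notin> Kfield \<and> y \<notin> Kfield \<and> x + y \<in> Kfield \<and> x * y \<in> Kfield"

lemma Kconj_sym: "Kconj x y \<Longrightarrow> Kconj y x"
  by (simp add: Kconj_def add.commute mult.commute)

lemma Kconj_quadratic:
  assumes "Kconj x y"
  shows "\<exists>a b c. a \<in> Rpoly \<and> b \<in> Rpoly \<and> c \<in> Rpoly \<and> a \<noteq> 0 \<and> a * x^2 + b * x + c = 0 \<and> y = - b / a - x"
proof -
  from assms obtain P Q P' Q' where *:
    "P \<in> Rpoly" "Q \<in> Rpoly" "Q \<noteq> 0" "x + y = P / Q"
    "P' \<in> Rpoly" "Q' \<in> Rpoly" "Q' \<noteq> 0" "x * y = P' / Q'"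
    unfolding Kconj_def by (elim conjE KfieldE)
  have "Q * Q' * x^2 + - (P * Q') * x + P' * Q = Q * Q' * (x^2 - (x + y) * x + x * y)"
    unfolding * using *(3,7) by (simp add: field_simps)
  hence "Q * Q' * x^2 + - (P * Q') * x + P' * Q = 0"
    by (simp add: power2_eq_square algebra_simps)
  moreover have "y = - (- (P * Q')) / (Q * Q') - x"
    using * by (simp add: field_simps)
  ultimately show ?thesis using *
    by (intro exI[of _ "Q * Q'"] exI[of _ "- (P * Q')"] exI[of _ "P' * Q"]) auto
qed

lemma Kconj_Kquad: "Kconj x y \<Longrightarrow> x \<in> Kquad"
  using Kconj_quadratic[of x y] by (auto simp: Kquad_def Kconj_def)

text \<open>Uniqueness of the conjugate: if \<open>z\<close> is another candidate, then
  \<open>y - z\<close> and \<open>x * (y - z)\<close> both lie in K, so a nonzero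
  \<open>y - z\<close> would put \<open>x\<close> in K.\<close>

lemma Kconj_qconj:
  assumes "Kconj x y"
  shows "qconj x = y"
  unfolding qconj_def
proof (rule the_equality)
  show "\<exists>a b c. a \<in> Rpoly \<and> b \<in> Rpoly \<and> c \<in> Rpoly \<and> a \<noteq> 0 \<and> a * x^2 + b * x + c = 0 \<and> y = - b / a - x"
    by (rule Kconj_quadratic[OF assms])
next
  fix z assume "\<exists>a b c. a \<in> Rpoly \<and> b \<in> Rpoly \<and> c \<in> Rpoly \<and> a \<noteq> 0 \<and> a * x^2 + b * x + c = 0 \<and> z = - b / a - x"
  then obtain a b c where *: "a \<in> Rpoly" "b \<in> Rpoly" "c \<in> Rpoly" "a \<noteq> 0"
    "a * x^2 + b * x + c = 0" "z = - b / a - x" by blast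
  have sum: "x + z = - b / a" using * by simp
  have "a * (x * (x + z) - x^2) = - b * x - a * x^2" unfolding sum using *(4) by (simp add: field_simps)
  also have "\<dots> = c - (a * x^2 + b * x + c)" by simp
  finally have "a * (x * (x + z) - x^2) = c" using *(5) by simp
  hence prod: "x * z = c / a"
    using *(4) by (simp add: field_simps power2_eq_square)
  have Kz: "x + z \<in> Kfield" "x * z \<in> Kfield"
    unfolding sum prod using * by (blast intro: KfieldI)+
  have K: "y - z \<in> Kfield" "x * (y - z) \<in> Kfield"
    using Kfield_diff[of "x + y" "x + z"] Kfield_diff[of "x * y" "x * z"] Kz assms
    by (simp_all add: Kconj_def algebra_simps)
  show "z = y"
  proof (rule ccontr)
    assume "z \<noteq> y"
    hence "x * (y - z) / (y - z) = x" by simp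
    thus False using assms Kfield_divide[OF K(2,1)] by (simp add: Kconj_def)
  qed
qed

text \<open>Over the common denominator \<open>D\<close>, the sum and the product of the images are
  symmetric in \<open>x\<close> and \<open>y\<close>, hence polynomial expressions in
  \<open>x + y\<close> and \<open>x * y\<close>.\<close>

lemma Kconj_homog:
  assumes "Kconj x y" and g: "pgl2R a b c d"
  shows "Kconj (homog a b c d x) (homog a b c d y)"
proof -
  have R: "a \<in> Rpoly" "b \<in> Rpoly" "c \<in> Rpoly" "d \<in> Rpoly" using g by (auto simp: pgl2R_def)
  have xy: "x \<notin> Kfield" "y \<notin> Kfield" "x + y \<in> Kfield" "x * y \<in> Kfield" using assms by (auto simp: Kconj_def)
  define D where "D = (c * x + d) * (c * y + d)"
  have nz: "c * x + d \<noteq> 0" "c * y + d \<noteq> 0" by (rule pgl2R_denominator[OF g]; fact)+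
  have D: "D = c * c * (x * y) + c * d * (x + y) + d * d" by (simp add: D_def algebra_simps)
  have "homog a b c d x + homog a b c d y
      = ((a * x + b) * (c * y + d) + (a * y + b) * (c * x + d)) / D"
    using nz unfolding homog_def D_def by (simp add: add_frac_eq)
  also have "(a * x + b) * (c * y + d) + (a * y + b) * (c * x + d)
      = a * c * (x * y) + a * c * (x * y) + (a * d + b * c) * (x + y) + b * d + b * d"
    by (simp add: algebra_simps)
  finally have eq: "homog a b c d x + homog a b c d y = \<dots> / D" .
  have 1: "homog a b c d x + homog a b c d y \<in> Kfield"
    unfolding eq D by (intro Kfield_intros R[THEN Kfield_Rpoly] xy)
  have "homog a b c d x * homog a b c d y = (a * x + b) * (a * y + b) / D"
    unfolding homog_def D_def by simp
  also have "(a * x + b) * (a * y + b) = a * a * (x * y) + a * b * (x + y) + b * b"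
    by (simp add: algebra_simps)
  finally have eq: "homog a b c d x * homog a b c d y = \<dots> / D" .
  have 2: "homog a b c d x * homog a b c d y \<in> Kfield"
    unfolding eq D by (intro Kfield_intros R[THEN Kfield_Rpoly] xy)
  show ?thesis using 1 2 xy g by (simp add: Kconj_def homog_notin_Kfield)
qed

lemma Theta_cases:
  assumes "Kconj \<alpha> \<alpha>'" "\<beta> \<in> Theta \<alpha>"
  obtains a b c d where "pgl2R a b c d" "\<beta> = homog a b c d \<alpha>" "qconj \<beta> = homog a b c d \<alpha>'"
    | a b c d where "pgl2R a b c d" "\<beta> = homog a b c d \<alpha>'" "qconj \<beta> = homog a b c d \<alpha>"
proof -
  from assms obtain a b c d where "pgl2R a b c d" "\<beta> = homog a b c d \<alpha> \<or> \<beta> = homog a b c d \<alpha>'"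
    unfolding Theta_def Kconj_qconj[OF assms(1)] by blast
  thus ?thesis
    using that Kconj_qconj[OF Kconj_homog[OF assms(1)]] Kconj_qconj[OF Kconj_homog[OF Kconj_sym[OF assms(1)]]]
    by blast
qed

section \<open>Continued fractions\<close>

text \<open>The zeroth entry must be nonconstant as well, so that every tail is again such a
  sequence.\<close>

definition cf_seq :: "(nat \<Rightarrow> 'a::{field,finite} fls) \<Rightarrow> bool" where
  "cf_seq a \<longleftrightarrow> (\<forall>i. a i \<in> Rpoly \<and> habs (a i) > 1)"

primrec cf_approx :: "nat \<Rightarrow> (nat \<Rightarrow> 'a::{field,finite} fls) \<Rightarrow> 'a fls" where
  "cf_approx 0 a = a 0"
| "cf_approx (Suc n) a = a 0 + 1 / cf_approx n (\<lambda>i. a (Suc i))"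

lemma cf_seq_Suc: "cf_seq a \<Longrightarrow> cf_seq (\<lambda>i. a (Suc i))"
  by (simp add: cf_seq_def)

lemma cf_approx_habs: "cf_seq a \<Longrightarrow> habs (cf_approx n a) = habs (a 0)"
proof (induction n arbitrary: a)
  case (Suc n)
  have "habs (cf_approx n (\<lambda>i. a (Suc i))) > 1"
    using Suc.IH[OF cf_seq_Suc[OF Suc.prems]] Suc.prems by (simp add: cf_seq_def)
  hence "habs (1 / cf_approx n (\<lambda>i. a (Suc i))) < 1" by (simp add: divide_less_eq)
  also have "1 < habs (a 0)" using Suc.prems by (simp add: cf_seq_def)
  finally show ?case by (simp add: habs_add_eq_left)
qed auto

text \<open>Outside the closed unit ball both factors of the denominator \<open>x * y\<close> have
  size at least q. This contraction drives the convergence of continued fractions.\<close>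

lemma habs_inverse_diff_le:
  fixes x y :: "'a::{field,finite} fls"
  assumes "habs x > 1" "habs y > 1"
  shows "habs (1 / x - 1 / y) \<le> habs (x - y) / real CARD('a) ^ 2"
proof -
  have nz: "x \<noteq> 0" "y \<noteq> 0" using assms by auto
  hence "1 / x - 1 / y = (y - x) / (x * y)" by (simp add: field_simps)
  hence "habs (1 / x - 1 / y) = habs (x - y) / (habs x * habs y)"
    by (simp add: habs_minus_commute)
  also have "\<dots> \<le> habs (x - y) / (real CARD('a) * real CARD('a))"
    using assms[THEN habs_gt_1_imp] nz by (intro divide_left_mono mult_mono) auto
  finally show ?thesis by (simp add: power2_eq_square)
qed

lemma cf_approx_diff:
  "cf_seq a \<Longrightarrow> habs (cf_approx (Suc n) a - cf_approx n (a::nat \<Rightarrow> 'a::{field,finite} fls)) < 1 / real CARD('a) ^ n"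
proof (induction n arbitrary: a)
  case 0
  hence "habs (1 / a 1) < 1" by (simp add: cf_seq_def divide_less_eq)
  thus ?case by simp
next
  case (Suc n)
  let ?a = "\<lambda>i. a (Suc i)"
  have a: "cf_seq ?a" by (rule cf_seq_Suc) fact
  have gt: "habs (cf_approx k ?a) > 1" for k
    using cf_approx_habs[OF a] a by (simp add: cf_seq_def)
  have q: "real CARD('a) > 1" by (rule card_field_gt_1)
  have "cf_approx (Suc (Suc n)) a - cf_approx (Suc n) a
      = 1 / cf_approx (Suc n) ?a - 1 / cf_approx n ?a" by simp
  hence "habs (cf_approx (Suc (Suc n)) a - cf_approx (Suc n) a)
      \<le> habs (cf_approx (Suc n) ?a - cf_approx n ?a) / real CARD('a) ^ 2"
    using habs_inverse_diff_le[OF gt gt] by metis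
  also have "\<dots> < (1 / real CARD('a) ^ n) / real CARD('a) ^ 2"
    using Suc.IH[OF a] q by (intro divide_strict_right_mono) auto
  also have "\<dots> \<le> 1 / real CARD('a) ^ Suc n"
    using q by (simp add: divide_le_eq power2_eq_square)
  finally show ?case .
qed

definition cf :: "(nat \<Rightarrow> 'a::{field,finite} fls) \<Rightarrow> 'a fls" where
  "cf a = (SOME l. \<forall>n. habs (l - cf_approx n a) < 1 / real CARD('a) ^ n)"

lemma cf_approx_cf:
  assumes "cf_seq a"
  shows "habs (cf a - cf_approx n (a::nat \<Rightarrow> 'a::{field,finite} fls)) < 1 / real CARD('a) ^ n"
  using someI_ex[OF fls_complete[of "\<lambda>n. cf_approx n a", OF cf_approx_diff[OF assms]]]
  unfolding cf_def by (rule spec)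

lemma cf_floor: "cf_seq a \<Longrightarrow> habs (cf a - a 0) < 1"
  using cf_approx_cf[of a 0] by simp

lemma cf_habs: "cf_seq a \<Longrightarrow> habs (cf a) = habs (a 0)"
  using cf_floor[of a] less_trans[of _ 1 "habs (a 0)"]
  by (intro habs_eq_if_close) (simp add: cf_seq_def)

text \<open>The recursion of \<open>cf_approx\<close> passes to the limit: the defect
  \<open>e\<close> is smaller than every q^-n, hence zero.\<close>

lemma cf_Suc:
  assumes a: "cf_seq (a::nat \<Rightarrow> 'a::{field,finite} fls)"
  shows "cf a = a 0 + 1 / cf (\<lambda>i. a (Suc i))"
proof (rule ccontr)
  let ?a = "\<lambda>i. a (Suc i)"
  define e where "e = cf a - (a 0 + 1 / cf ?a)"
  assume "cf a \<noteq> a 0 + 1 / cf ?a"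
  hence e: "habs e > 0" by (simp add: e_def)
  have a': "cf_seq ?a" by (rule cf_seq_Suc) fact
  have q: "real CARD('a) > 1" by (rule card_field_gt_1)
  have gt: "habs (cf ?a) > 1" "habs (cf_approx n ?a) > 1" for n
    using cf_habs[OF a'] cf_approx_habs[OF a'] a' by (simp_all add: cf_seq_def)
  have "habs e < 1 / real CARD('a) ^ n" for n
  proof -
    have "1 / real CARD('a) ^ Suc n \<le> 1 / real CARD('a) ^ n"
      using q by (intro divide_left_mono power_increasing) auto
    hence 1: "habs (cf a - cf_approx (Suc n) a) < 1 / real CARD('a) ^ n"
      using cf_approx_cf[OF a, of "Suc n"] by linarith
    have "habs (1 / cf ?a - 1 / cf_approx n ?a) \<le> habs (cf ?a - cf_approx n ?a) / real CARD('a) ^ 2"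
      by (rule habs_inverse_diff_le[OF gt])
    also have "\<dots> \<le> habs (cf ?a - cf_approx n ?a) / 1"
      using q by (intro divide_left_mono) auto
    also have "\<dots> < 1 / real CARD('a) ^ n" using cf_approx_cf[OF a', of n] by simp
    finally have 2: "habs (1 / cf ?a - 1 / cf_approx n ?a) < 1 / real CARD('a) ^ n" .
    have "e = (cf a - cf_approx (Suc n) a) - (1 / cf ?a - 1 / cf_approx n ?a)"
      by (simp add: e_def)
    thus ?thesis using habs_diff_less[OF 1 2] by simp
  qed
  hence "real CARD('a) ^ n < 1 / habs e" for n
    using e q by (simp add: field_simps)
  thus False using real_arch_pow[OF q, of "1 / habs e"] less_asym by blast
qed

section \<open>Convergents and complete quotients\<close>

fun convP :: "(nat \<Rightarrow> 'a::{field,finite} fls) \<Rightarrow> nat \<Rightarrow> 'a fls" where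
  "convP a 0 = 1"
| "convP a (Suc 0) = a 0"
| "convP a (Suc (Suc n)) = a (Suc n) * convP a (Suc n) + convP a n"

text \<open>Index 0 is the formal convergent 1/0, so
  \<open>convP a (Suc n) / convQ a (Suc n)\<close> is the convergent ending in the partial quotient
  \<open>a n\<close>.\<close>

fun convQ :: "(nat \<Rightarrow> 'a::{field,finite} fls) \<Rightarrow> nat \<Rightarrow> 'a fls" where
  "convQ a 0 = 0"
| "convQ a (Suc 0) = 1"
| "convQ a (Suc (Suc n)) = a (Suc n) * convQ a (Suc n) + convQ a n"

lemma conv_Rpoly:
  assumes "\<And>i. a i \<in> Rpoly"
  shows "convP a n \<in> Rpoly" "convQ a n \<in> Rpoly"
  using assms by (induction a n rule: convP.induct) auto

lemma conv_det: "convP a (Suc n) * convQ a n - convP a n * convQ a (Suc n) = (- 1) ^ Suc n"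
proof (induction n)
  case (Suc n)
  have "convP a (Suc (Suc n)) * convQ a (Suc n) - convP a (Suc n) * convQ a (Suc (Suc n))
    = - (convP a (Suc n) * convQ a n - convP a n * convQ a (Suc n))"
    by (simp add: algebra_simps)
  thus ?case unfolding Suc.IH by simp
qed simp

lemma conv_pgl2R:
  assumes "\<And>i. a i \<in> Rpoly"
  shows "pgl2R (convP a (Suc n)) (convP a n) (convQ a (Suc n)) (convQ a n)"
proof -
  have "(- 1) ^ Suc n = (fls_const ((- 1) ^ Suc n) :: 'a fls)"
    by (metis fls_const_1 fls_const_power fls_const_uminus)
  thus ?thesis unfolding pgl2R_def conv_det[of a n]
    using conv_Rpoly[OF assms] by (intro conjI exI[of _ "(- 1) ^ Suc n"]) auto
qed

text \<open>Multiplied out and free of size conditions, so that it also applies to the conjugate,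
  whose complete quotients \<open>past n\<close> are small.\<close>

lemma conv_complete_quotient:
  assumes "\<And>n. x n = a n + 1 / x (Suc n)" "\<And>n. x (Suc n) \<noteq> 0"
  shows "x 0 * (convQ a (Suc n) * x (Suc n) + convQ a n) = convP a (Suc n) * x (Suc n) + convP a n"
proof (induction n)
  case 0
  show ?case using assms(1)[of 0] assms(2)[of 0] by (simp add: field_simps)
next
  case (Suc n)
  let ?z = "x (Suc (Suc n))"
  have z: "?z \<noteq> 0" "x (Suc n) * ?z = a (Suc n) * ?z + 1"
    using assms(2)[of "Suc n"] by (simp_all add: assms(1)[of "Suc n"] distrib_right)
  have "x 0 * (convQ a (Suc (Suc n)) * ?z + convQ a (Suc n))
    = x 0 * (convQ a (Suc n) * (a (Suc n) * ?z + 1) + convQ a n * ?z)" by (simp add: algebra_simps)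
  also have "\<dots> = (x 0 * (convQ a (Suc n) * x (Suc n) + convQ a n)) * ?z"
    unfolding z(2)[symmetric] by (simp add: algebra_simps)
  also have "\<dots> = convP a (Suc n) * (x (Suc n) * ?z) + convP a n * ?z"
    unfolding Suc.IH by (simp add: algebra_simps)
  also have "\<dots> = convP a (Suc (Suc n)) * ?z + convP a (Suc n)"
    unfolding z(2) by (simp add: algebra_simps)
  finally show ?case .
qed

text \<open>\<open>x n\<close> are the complete and \<open>a n\<close> the partial quotients of
  \<open>x 0\<close>. The size condition starts at index 1, so that an arbitrary irrational element
  has such an expansion.\<close>

locale cf_expansion =
  fixes x a :: "nat \<Rightarrow> 'a::{field,finite} fls"
  assumes a_Rpoly: "a n \<in> Rpoly"
    and x_Suc: "x n = a n + 1 / x (Suc n)"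
    and x_gt_1: "habs (x (Suc n)) > 1"
begin

abbreviation "P \<equiv> convP a"
abbreviation "Q \<equiv> convQ a"

lemma x_nz: "x (Suc n) \<noteq> 0"
  using x_gt_1[of n] by auto

lemma habs_a: "habs (a (Suc n)) = habs (x (Suc n))"
proof -
  have "a (Suc n) - x (Suc n) = - (1 / x (Suc (Suc n)))" using x_Suc[of "Suc n"] by simp
  hence "habs (a (Suc n) - x (Suc n)) = 1 / habs (x (Suc (Suc n)))" by simp
  also have "\<dots> < 1" using x_gt_1[of "Suc n"] by (simp add: divide_less_eq)
  finally have "habs (a (Suc n) - x (Suc n)) < 1" .
  thus ?thesis using x_gt_1[of n] by (intro habs_eq_if_close) simp
qed

text \<open>Both claims need each other: strict growth makes the term
  \<open>a (Suc n) * Q (Suc n)\<close> dominate in the recursion, and the resulting size gives the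
  next growth.\<close>

lemma Q_habs_step: "habs (Q n) < habs (Q (Suc n)) \<and> habs (Q (Suc (Suc n))) = habs (a (Suc n)) * habs (Q (Suc n))"
proof (induction n)
  case (Suc n)
  have *: "habs (Q (Suc n)) < habs (Q (Suc (Suc n)))" "habs (a (Suc (Suc n))) > 1"
  proof -
    have "0 < habs (Q (Suc n))" using Suc by (metis habs_nonneg le_less_trans)
    thus "habs (Q (Suc n)) < habs (Q (Suc (Suc n)))"
      using Suc x_gt_1[of n] by (simp add: habs_a)
    show "habs (a (Suc (Suc n))) > 1" using x_gt_1[of "Suc n"] habs_a by metis
  qed
  hence "habs (Q (Suc n)) < habs (a (Suc (Suc n)) * Q (Suc (Suc n)))"
    using mult_strict_mono[of 1 "habs (a (Suc (Suc n)))" "habs (Q (Suc n))" "habs (Q (Suc (Suc n)))"]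
      le_less_trans[OF habs_nonneg *(1)] le_less_trans[OF zero_le_one *(2)] by (simp del: convQ.simps habs_pos_iff)
  thus ?case using * by (simp del: convQ.simps add: convQ.simps(3)[of a "Suc n"] habs_add_eq_left)
qed simp

lemma Q_less: "habs (Q n) < habs (Q (Suc n))"
  and Q_habs_Suc: "habs (Q (Suc (Suc n))) = habs (a (Suc n)) * habs (Q (Suc n))"
  using Q_habs_step by blast+

lemma Q_nz: "Q (Suc n) \<noteq> 0"
  using le_less_trans[OF habs_nonneg Q_less[of n]] by simp

lemma Q_ge: "habs (Q (Suc n)) \<ge> real CARD('a) ^ n"
proof (induction n)
  case (Suc n)
  have "habs (a (Suc n)) \<ge> real CARD('a)"
    using x_gt_1[of n] habs_a habs_gt_1_imp by metis
  thus ?case unfolding Q_habs_Suc power_Suc using Suc by (intro mult_mono) auto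
qed simp

lemma Q_large: "\<exists>N. \<forall>n\<ge>N. habs (Q (Suc n)) > c"
proof -
  obtain N where N: "c < real CARD('a) ^ N"
    using real_arch_pow[OF card_field_gt_1] by blast
  have "c < habs (Q (Suc n))" if "n \<ge> N" for n
  proof -
    have "real CARD('a) ^ N \<le> real CARD('a) ^ n"
      using that card_field_gt_1[where 'a='a] by (intro power_increasing) auto
    thus ?thesis using N Q_ge[of n] by linarith
  qed
  thus ?thesis by blast
qed

lemma denominator_habs: "habs (Q (Suc n) * x (Suc n) + Q n) = habs (Q (Suc n)) * habs (x (Suc n))"
proof -
  have "habs (Q n) < habs (Q (Suc n)) * 1" using Q_less by simp
  also have "\<dots> < habs (Q (Suc n)) * habs (x (Suc n))"
    using x_gt_1[of n] Q_nz[of n] by (intro mult_strict_left_mono) auto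
  finally show ?thesis by (simp add: habs_add_eq_left)
qed

lemma x_0_mult: "x 0 * (Q (Suc n) * x (Suc n) + Q n) = P (Suc n) * x (Suc n) + P n"
  by (rule conv_complete_quotient) (rule x_Suc, rule x_nz)

lemma x_0_eq: "x 0 = homog (P (Suc n)) (P n) (Q (Suc n)) (Q n) (x (Suc n))"
proof -
  have "habs (Q (Suc n) * x (Suc n) + Q n) > 0"
    unfolding denominator_habs using x_nz[of n] Q_nz[of n] by simp
  hence "Q (Suc n) * x (Suc n) + Q n \<noteq> 0" by auto
  thus ?thesis unfolding homog_def x_0_mult[of n, symmetric] by simp
qed

text \<open>After clearing the denominator \<open>D\<close> of the complete quotient, the numerator
  is the determinant of the convergent matrix, of size 1, and \<open>D\<close> has exactly the size
  of the next denominator.\<close>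

lemma approximation: "habs (P (Suc n) - Q (Suc n) * x 0) = 1 / habs (Q (Suc (Suc n)))"
proof -
  define D where "D = Q (Suc n) * x (Suc n) + Q n"
  have D: "habs D = habs (Q (Suc (Suc n)))"
    unfolding D_def denominator_habs Q_habs_Suc habs_a by simp
  hence nz: "D \<noteq> 0" using Q_nz[of "Suc n"] by (metis habs_eq_0_iff)
  have "P (Suc n) - Q (Suc n) * x 0 = (P (Suc n) * D - Q (Suc n) * (x 0 * D)) / D"
    using nz by (simp add: field_simps)
  also have "x 0 * D = P (Suc n) * x (Suc n) + P n"
    unfolding D_def by (rule x_0_mult)
  also have "P (Suc n) * D - Q (Suc n) * (P (Suc n) * x (Suc n) + P n) = (- 1) ^ Suc n"
    unfolding conv_det[of a n, symmetric] D_def by (simp add: algebra_simps)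
  finally show ?thesis by (simp add: D)
qed

text \<open>If \<open>x 0\<close> were p/q, then \<open>q * P (Suc n) - p * Q (Suc n)\<close> would
  be a nonzero polynomial of absolute value below 1 as soon as the next denominator exceeds
  |q|.\<close>

lemma x_notin_Kfield: "x 0 \<notin> Kfield"
proof
  assume "x 0 \<in> Kfield"
  then obtain p q where pq: "p \<in> Rpoly" "q \<in> Rpoly" "q \<noteq> 0" "x 0 = p / q" by (rule KfieldE)
  obtain n where "\<forall>k\<ge>n. habs (Q (Suc k)) > habs q"
    using Q_large by blast
  hence n: "habs (Q (Suc (Suc n))) > habs q"
    by (blast intro: le_SucI)
  have "q * P (Suc n) - p * Q (Suc n) = q * (P (Suc n) - Q (Suc n) * x 0)"
    using pq by (simp add: algebra_simps)
  hence eq: "habs (q * P (Suc n) - p * Q (Suc n)) = habs q / habs (Q (Suc (Suc n)))"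
    by (simp add: approximation)
  have lt: "habs q / habs (Q (Suc (Suc n))) < 1"
    using n le_less_trans[OF habs_nonneg n] by (simp add: divide_less_eq)
  have gt: "habs q / habs (Q (Suc (Suc n))) > 0"
    using pq Q_nz[of "Suc n"] by (simp del: convQ.simps)
  have R: "q * P (Suc n) - p * Q (Suc n) \<in> Rpoly"
    using pq conv_Rpoly[OF a_Rpoly] by (intro Rpoly_diff Rpoly_mult)
  have "q * P (Suc n) - p * Q (Suc n) = 0"
    by (rule Rpoly_habs_less_1[OF R]) (simp only: eq lt)
  thus False using gt unfolding eq[symmetric] by simp
qed

end

lemma cf_expansion_cf:
  assumes "cf_seq a"
  shows "cf_expansion (\<lambda>n. cf (\<lambda>i. a (n + i))) a"
proof
  have s: "cf_seq (\<lambda>i. a (n + i))" for n using assms by (simp add: cf_seq_def)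
  fix n
  show "a n \<in> Rpoly" using assms by (simp add: cf_seq_def)
  show "cf (\<lambda>i. a (n + i)) = a n + 1 / cf (\<lambda>i. a (Suc n + i))"
    using cf_Suc[OF s[of n]] by simp
  show "habs (cf (\<lambda>i. a (Suc n + i))) > 1"
    using cf_habs[OF s[of "Suc n"]] assms by (simp add: cf_seq_def)
qed

lemma cf_expansion_exists:
  assumes "f \<notin> Kfield"
  shows "\<exists>x a. cf_expansion x a \<and> x 0 = f"
proof -
  obtain fl :: "'a fls \<Rightarrow> 'a fls" where fl: "fl y \<in> Rpoly" "habs (y - fl y) < 1" for y
    using Rpoly_floor by metis
  define x where "x = rec_nat f (\<lambda>_ y. 1 / (y - fl y))"
  have x0: "x 0 = f" and xS: "x (Suc n) = 1 / (x n - fl (x n))" for n by (simp_all add: x_def)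
  have K: "x n \<notin> Kfield" for n
  proof (induction n)
    case (Suc n)
    show ?case
    proof
      assume "x (Suc n) \<in> Kfield"
      hence "fl (x n) + 1 / x (Suc n) \<in> Kfield"
        by (intro Kfield_add Kfield_divide Kfield_Rpoly[OF fl(1)] Kfield_Rpoly[OF Rpoly_1])
      thus False using Suc unfolding xS by simp
    qed
  qed (simp add: x0 assms)
  have nz: "x n - fl (x n) \<noteq> 0" for n using K[of n] Kfield_Rpoly[OF fl(1)[of "x n"]] by auto
  have "cf_expansion x (\<lambda>n. fl (x n))"
  proof
    fix n
    show "fl (x n) \<in> Rpoly" by (rule fl)
    show "x n = fl (x n) + 1 / x (Suc n)" by (simp add: xS)
    show "habs (x (Suc n)) > 1" using fl(2)[of "x n"] nz[of n]
      unfolding xS by (simp add: less_divide_eq)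
  qed
  thus ?thesis using x0 by blast
qed

section \<open>Values of the norm form along a bi-infinite continued fraction\<close>

text \<open>This is |F(p,q)| / sqrt |disc F| for the binary form F = (p - q x)(p - q y), which
  explains its invariance under unimodular substitutions.\<close>

definition fval :: "'a::{field,finite} fls \<Rightarrow> 'a fls \<Rightarrow> 'a fls \<Rightarrow> 'a fls \<Rightarrow> real" where
  "fval x y p q = habs (p - q * x) * habs (p - q * y) / habs (x - y)"

lemma fval_nonneg [simp]: "fval x y p q \<ge> 0"
  by (simp add: fval_def)

lemma fval_commute: "fval x y p q = fval y x p q"
  by (simp add: fval_def habs_minus_commute mult.commute)

lemma homog_diff:
  assumes "c * x + d \<noteq> 0" "c * y + d \<noteq> 0"
  shows "homog a b c d x - homog a b c d y = (a * d - b * c) * (x - y) / ((c * x + d) * (c * y + d))"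
  using assms by (simp add: homog_def diff_frac_eq) (simp add: algebra_simps)

lemma pgl2R_habs_det: "pgl2R a b c d \<Longrightarrow> habs (a * d - b * c) = 1"
  by (auto simp: pgl2R_def)

lemma fval_homog:
  assumes g: "pgl2R a b c d" and "x \<notin> Kfield" "y \<notin> Kfield"
  shows "fval (homog a b c d x) (homog a b c d y) p q = fval x y (d * p - b * q) (a * q - c * p)"
proof -
  have nz: "c * x + d \<noteq> 0" "c * y + d \<noteq> 0" by (rule pgl2R_denominator[OF g]; fact)+
  have lin: "p - q * homog a b c d z = ((d * p - b * q) - (a * q - c * p) * z) / (c * z + d)"
    if "c * z + d \<noteq> 0" for z
    using that by (simp add: homog_def field_simps)
  show ?thesis
    unfolding fval_def homog_diff[OF nz] lin[OF nz(1)] lin[OF nz(2)]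
    using nz pgl2R_habs_det[OF g] by simp
qed

text \<open>Applied to the two columns of a matrix in \<open>GL\<^sub>2(R)\<close>, the values of \<open>fval\<close> measure how deeply
  the geodesic between \<open>x\<close> and \<open>y\<close> enters the horoballs at two neighbouring cusps.\<close>

definition shallow :: "nat \<Rightarrow> 'a::{field,finite} fls \<Rightarrow> 'a fls \<Rightarrow> bool" where
  "shallow m x y \<longleftrightarrow>
     (\<forall>p\<in>Rpoly. \<forall>q\<in>Rpoly. p \<noteq> 0 \<or> q \<noteq> 0 \<longrightarrow> fval x y p q \<ge> 1 / real CARD('a) ^ m) \<and>
     (\<forall>p q r s. pgl2R p r q s \<longrightarrow> fval x y p q * fval x y r s \<ge> 1 / real CARD('a) ^ m)"

lemma shallow_commute: "shallow m x y \<longleftrightarrow> shallow m y x"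
  by (simp add: shallow_def fval_commute[of x y])

lemma shallow_homog:
  assumes g: "pgl2R a b c d" and K: "x \<notin> Kfield" "y \<notin> Kfield" and sh: "shallow m x (y::'a::{field,finite} fls)"
  shows "shallow m (homog a b c d x) (homog a b c d y)"
  unfolding shallow_def fval_homog[OF g K]
proof (intro conjI ballI impI allI)
  fix p q :: "'a fls" assume pq: "p \<in> Rpoly" "q \<in> Rpoly" "p \<noteq> 0 \<or> q \<noteq> 0"
  have R: "a \<in> Rpoly" "b \<in> Rpoly" "c \<in> Rpoly" "d \<in> Rpoly" using g by (auto simp: pgl2R_def)
  have nz: "a * d - b * c \<noteq> 0" using pgl2R_habs_det[OF g] by auto
  have "d * p - b * q \<noteq> 0 \<or> a * q - c * p \<noteq> 0"
  proof (rule ccontr)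
    assume "\<not> ?thesis"
    hence 0: "d * p - b * q = 0" "a * q - c * p = 0" by auto
    \<comment> \<open>Cramer's rule: the adjugate matrix annihilates only the zero vector.\<close>
    have "(a * d - b * c) * p = a * (d * p - b * q) + b * (a * q - c * p)"
      "(a * d - b * c) * q = c * (d * p - b * q) + d * (a * q - c * p)"
      by (simp_all add: algebra_simps)
    thus False using pq(3) nz unfolding 0 by simp
  qed
  thus "1 / real CARD('a) ^ m \<le> fval x y (d * p - b * q) (a * q - c * p)"
    using sh pq R unfolding shallow_def by (blast intro: Rpoly_diff Rpoly_mult)
next
  fix p q r s :: "'a fls" assume "pgl2R p r q s"
  from pgl2R_mult[OF pgl2R_adjugate[OF g] this]
  have "pgl2R (d * p - b * q) (d * r - b * s) (a * q - c * p) (a * s - c * r)"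
    by (simp add: algebra_simps)
  thus "1 / real CARD('a) ^ m \<le> fval x y (d * p - b * q) (a * q - c * p) * fval x y (d * r - b * s) (a * s - c * r)"
    using sh unfolding shallow_def by blast
qed

section \<open>Bi-infinite sequences, their two ends, and descent on norm values\<close>

locale bi_cf =
  fixes b :: "int \<Rightarrow> 'a::{field,finite} fls" and m :: nat
  assumes b_Rpoly: "b n \<in> Rpoly"
    and b_gt_1: "habs (b n) > 1"
    and b_bound: "habs (b n) * habs (b (n + 1)) \<le> real CARD('a) ^ m"
begin

lemma b_nz [simp]: "b n \<noteq> 0"
  using b_gt_1[of n] by auto

definition fut :: "int \<Rightarrow> 'a fls" where
  "fut n = cf (\<lambda>i. b (n + int i))"

text \<open>The sign makes \<open>past\<close> obey the same recursion as \<open>fut\<close> (see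
  \<open>past_step\<close>), so that one shift is one homography acting on both ends. The entries
  read backwards start at \<open>n - 1\<close>.\<close>

definition past :: "int \<Rightarrow> 'a fls" where
  "past n = - 1 / cf (\<lambda>i. b (n - 1 - int i))"

lemma cf_seq_fut: "cf_seq (\<lambda>i. b (n + int i))" and cf_seq_past: "cf_seq (\<lambda>i. b (n - int i))"
  by (simp_all add: cf_seq_def b_Rpoly b_gt_1)

lemma fut_step: "fut n = b n + 1 / fut (n + 1)"
  using cf_Suc[OF cf_seq_fut[of n]] by (simp add: fut_def add.assoc)

lemma habs_fut: "habs (fut n) = habs (b n)"
  using cf_habs[OF cf_seq_fut[of n]] by (simp add: fut_def)

lemma past_step': "past (n + 1) = - 1 / (b n - past n)"
  using cf_Suc[OF cf_seq_past[of n]] by (simp add: past_def algebra_simps)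

lemma habs_past: "habs (past n) = 1 / habs (b (n - 1))"
  using cf_habs[OF cf_seq_past[of "n - 1"]] by (simp add: past_def)

lemma habs_past_less_1: "habs (past n) < 1"
  using b_gt_1[of "n - 1"] by (simp add: habs_past divide_less_eq)

lemma fut_nz: "fut n \<noteq> 0"
  using habs_fut[of n] b_gt_1[of n] by auto

lemma past_nz: "past n \<noteq> 0"
  using habs_past[of n] b_gt_1[of "n - 1"] by auto

lemma past_step: "past n = b n + 1 / past (n + 1)"
proof -
  have "b n - past n \<noteq> 0" using past_nz[of "n + 1"] unfolding past_step' by auto
  thus ?thesis unfolding past_step' by simp
qed

lemma cf_expansion_fut: "cf_expansion (\<lambda>i. fut (n + int i)) (\<lambda>i. b (n + int i))"
proof
  fix i
  show "b (n + int i) \<in> Rpoly" by (rule b_Rpoly)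
  show "fut (n + int i) = b (n + int i) + 1 / fut (n + int (Suc i))"
    using fut_step[of "n + int i"] by (simp add: algebra_simps)
  show "habs (fut (n + int (Suc i))) > 1" by (simp add: habs_fut b_gt_1)
qed

lemma fut_notin_Kfield: "fut n \<notin> Kfield"
  using cf_expansion.x_notin_Kfield[OF cf_expansion_fut[of n]] by simp

lemma past_notin_Kfield: "past n \<notin> Kfield"
proof
  assume "past n \<in> Kfield"
  hence "- 1 / past n \<in> Kfield"
    by (intro Kfield_divide Kfield_Rpoly[OF Rpoly_minus[OF Rpoly_1]])
  hence "cf (\<lambda>i. b (n - 1 - int i)) \<in> Kfield" by (simp add: past_def)
  moreover have "cf_seq (\<lambda>i. b (n - 1 - int i))" by (rule cf_seq_past)
  ultimately show False
    using cf_expansion.x_notin_Kfield[OF cf_expansion_cf] by fastforce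
qed

lemma habs_fut_past: "habs (fut n - past n) = habs (fut n)"
  using habs_past_less_1[of n] b_gt_1[of n] by (intro habs_diff_eq_left) (simp add: habs_fut)

abbreviation N :: "int \<Rightarrow> 'a fls \<Rightarrow> 'a fls \<Rightarrow> real" where
  "N n \<equiv> fval (fut n) (past n)"

lemma N_eq: "N n p q = habs (p - q * fut n) * habs (p - q * past n) / habs (b n)"
  by (simp add: fval_def habs_fut_past habs_fut)

text \<open>The shift is the substitution z = b_n + 1/z'. The denominators it produces have sizes
  \<open>habs (fut (n + 1))\<close> and 1 / \<open>habs (b n)\<close>, which exactly turns one
  normalisation into the next.\<close>

lemma N_step: "N n p q = N (n + 1) q (p - b n * q)"
proof -
  have *: "habs (p - q * (b n + 1 / z)) = habs (q - (p - b n * q) * z) / habs z" if "z \<noteq> 0" for z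
  proof -
    have "p - q * (b n + 1 / z) = - (q - (p - b n * q) * z) / z"
      using that by (simp add: field_simps)
    thus ?thesis by (simp only: habs_divide habs_minus)
  qed
  have "habs (past (n + 1)) = 1 / habs (b n)" using habs_past[of "n + 1"] by simp
  moreover have "N n p q = habs (q - (p - b n * q) * fut (n + 1)) / habs (fut (n + 1))
      * (habs (q - (p - b n * q) * past (n + 1)) / habs (past (n + 1))) / habs (b n)"
    unfolding N_eq by (simp only: fut_step[of n] past_step[of n] *[OF fut_nz] *[OF past_nz])
  ultimately show ?thesis
    using less_trans[OF zero_less_one b_gt_1[of n]] by (simp add: N_eq habs_fut)
qed

text \<open>A unimodular change of basis, accompanied by a shift of \<open>b\<close>, moves \<open>(p, q)\<close> to the cusp \<open>\<infinity>\<close>.\<close>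

definition reducible :: "int \<Rightarrow> 'a fls \<Rightarrow> 'a fls \<Rightarrow> bool" where
  "reducible n p q \<longleftrightarrow> (\<exists>k u v w z. pgl2R u v w z \<and> w * p + z * q = 0 \<and>
     (\<forall>r s. N n r s = N k (u * r + v * s) (w * r + z * s)))"

lemma reducible_0: "reducible n p 0"
  unfolding reducible_def
  by (rule exI[of _ n], rule exI[of _ 1], rule exI[of _ 0], rule exI[of _ 0], rule exI[of _ 1])
    (auto simp: pgl2R_def intro!: exI[of _ 1])

lemma reducible_step:
  assumes red: "reducible n' (u * p + v * q) (w * p + z * q)" and g: "pgl2R u v w z"
    and N: "\<And>r s. N n r s = N n' (u * r + v * s) (w * r + z * s)"
  shows "reducible n p q"
proof -
  from red obtain k u' v' w' z' where *: "pgl2R u' v' w' z'"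
    "w' * (u * p + v * q) + z' * (w * p + z * q) = 0"
    "\<And>r s. N n' r s = N k (u' * r + v' * s) (w' * r + z' * s)"
    unfolding reducible_def by blast
  have "N n r s = N k ((u' * u + v' * w) * r + (u' * v + v' * z) * s) ((w' * u + z' * w) * r + (w' * v + z' * z) * s)" for r s
    unfolding N *(3) by (simp add: algebra_simps)
  moreover have "(w' * u + z' * w) * p + (w' * v + z' * z) * q = 0"
    using *(2) by (simp add: algebra_simps)
  ultimately show ?thesis
    unfolding reducible_def using pgl2R_mult[OF *(1) g] by blast
qed

lemma reducible_forward: "reducible (n + 1) q (p - b n * q) \<Longrightarrow> reducible n p q"
  by (rule reducible_step[of "n + 1" 0 p 1 q 1 "- b n"])
    (auto simp: pgl2R_def b_Rpoly N_step[of n] intro!: exI[of _ "- 1"])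

lemma reducible_backward: "reducible (n - 1) (b (n - 1) * p + q) p \<Longrightarrow> reducible n p q"
  by (rule reducible_step[of "n - 1" "b (n - 1)" p 1 q 1 0])
    (auto simp: pgl2R_def b_Rpoly N_step[of "n - 1"] intro!: exI[of _ "- 1"])

text \<open>Without cancellation each factor is a maximum; choosing |q \<open>fut n\<close>| in the
  first and |p| in the second leaves |p| |q| after division by \<open>habs (b n)\<close>.\<close>

lemma N_ge_1:
  assumes p: "p \<in> Rpoly" "p \<noteq> 0" and q: "q \<in> Rpoly" "q \<noteq> 0"
    and ne: "habs p \<noteq> habs (q * fut n)" "habs p \<noteq> habs (q * past n)"
  shows "N n p q \<ge> 1"
proof -
  have "habs (b n) > 0" by (rule less_trans[OF zero_less_one b_gt_1])
  have "1 * habs (b n) * 1 \<le> habs q * habs (b n) * habs p"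
    using p q b_gt_1[of n] by (intro mult_mono Rpoly_habs_ge_1) (auto simp: Rpoly_habs_ge_1)
  also have "\<dots> \<le> habs (p - q * fut n) * habs (p - q * past n)"
    unfolding habs_diff_eq_max[OF ne(1)] habs_diff_eq_max[OF ne(2)]
    by (intro mult_mono) (auto simp: habs_fut le_max_iff_disj)
  finally show ?thesis unfolding N_eq using \<open>habs (b n) > 0\<close> by simp
qed

text \<open>By \<open>N_ge_1\<close>, a value below 1 with nonzero entries forces cancellation at
  one of the two ends. A shift towards that end preserves the value and lowers the larger of the two
  degrees, on which the induction runs.\<close>

lemma reducible_if_N_less_1:
  assumes "p \<in> Rpoly" "q \<in> Rpoly" "p \<noteq> 0 \<or> q \<noteq> 0" "N n p q < 1"
  shows "reducible n p q"
proof -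
  have main: "reducible n p q"
    if "p \<in> Rpoly" "q \<in> Rpoly" "p \<noteq> 0 \<or> q \<noteq> 0" "N n p q < 1"
      "habs p < real CARD('a) ^ d" "habs q < real CARD('a) ^ d" for d
    using that
  proof (induction d arbitrary: n p q)
    case 0
    thus ?case using Rpoly_habs_less_1 by auto
  next
    case (Suc d)
    note R = \<open>p \<in> Rpoly\<close> \<open>q \<in> Rpoly\<close>
    have le: "habs p \<le> real CARD('a) ^ d" "habs q \<le> real CARD('a) ^ d"
      using Suc.prems(5,6) by (simp_all only: habs_less_power_Suc)
    have b1: "habs (b n) > 1" "habs (b (n - 1)) > 1" by (rule b_gt_1)+
    have Nlt: "habs (p - q * fut n) * habs (p - q * past n) < habs (b n)"
      using Suc.prems(4) less_trans[OF zero_less_one b1(1)] unfolding N_eq by (simp only: pos_divide_less_eq mult_1)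
    \<comment> \<open>Euclidean descent: shift forward if \<open>p / q\<close> has the size of \<open>fut n\<close>, backward if that of \<open>past n\<close>.\<close>
    consider "q = 0" | "p = 0" "q \<noteq> 0" | "p \<noteq> 0" "q \<noteq> 0" "habs p = habs (q * fut n)"
      | "p \<noteq> 0" "q \<noteq> 0" "habs p = habs (q * past n)"
      using N_ge_1[OF R(1) _ R(2)] Suc.prems(4) by force
    thus ?case
    proof cases
      case 1
      thus ?thesis by (simp add: reducible_0)
    next
      case 2
      have "reducible (n - 1) (b (n - 1) * p + q) p" unfolding 2 by (rule reducible_0)
      thus ?thesis by (rule reducible_backward)
    next
      case 3
      have q1: "habs q \<ge> 1" using 3 R by (intro Rpoly_habs_ge_1)
      have lt: "habs q < habs p" using 3 b1 by (simp add: habs_fut)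
      have "habs (q * past n) < habs p"
      proof -
        have "habs q * habs (past n) \<le> habs q * 1"
          using habs_past_less_1[of n] by (intro mult_left_mono) auto
        thus ?thesis using lt by simp
      qed
      \<comment> \<open>The factor without cancellation is known exactly, so the small product
        forces the other factor below 1.\<close>
      hence "habs (p - q * past n) = habs q * habs (b n)"
        using 3 by (simp add: habs_diff_eq_left habs_fut)
      hence "(habs (p - q * fut n) * habs q) * habs (b n) < 1 * habs (b n)"
        using Nlt by (simp add: mult.assoc)
      hence "habs (p - q * fut n) * habs q < 1" using b1 by (simp only: mult_less_cancel_right_pos)
      moreover have "habs (p - q * fut n) * 1 \<le> habs (p - q * fut n) * habs q"
        using q1 by (intro mult_left_mono) auto
      ultimately have "habs (p - q * fut n) < 1" by linarith
      hence 1: "habs (p - q * fut n) < habs p" using q1 lt by linarith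
      have "habs q / habs (b (n + 1)) \<le> habs q / 1"
        using b_gt_1[of "n + 1"] by (intro divide_left_mono) auto
      hence 2: "habs (q / fut (n + 1)) < habs p" using lt by (simp add: habs_fut)
      have "p - b n * q = (p - q * fut n) + q / fut (n + 1)"
        using fut_step[of n] by (simp add: algebra_simps)
      hence "habs (p - b n * q) < habs p" using habs_add_less[OF 1 2] by metis
      moreover have "p - b n * q \<in> Rpoly" using R b_Rpoly by blast
      moreover have "N (n + 1) q (p - b n * q) < 1" using Suc.prems(4) by (simp flip: N_step)
      ultimately have "reducible (n + 1) q (p - b n * q)"
        using R 3(2) less_le_trans[OF lt le(1)] less_le_trans[OF _ le(1)]
        by (intro Suc.IH) auto
      thus ?thesis by (rule reducible_forward)
    next
      case 4
      let ?b = "b (n - 1)"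
      have p1: "habs p \<ge> 1" using 4 R by (intro Rpoly_habs_ge_1)
      have pq: "habs p * habs ?b = habs q" using 4 b1 by (simp add: habs_past)
      have lt: "habs p < habs q"
        using p1 b1 unfolding pq[symmetric] by (simp add: mult_less_cancel_left1)
      have "habs p < habs (q * fut n)"
      proof -
        have "habs q * 1 \<le> habs q * habs (b n)"
          using b1 by (intro mult_left_mono) auto
        thus ?thesis using lt by (simp add: habs_fut)
      qed
      hence "habs (p - q * fut n) = habs q * habs (b n)"
        by (simp add: habs_diff_eq_right habs_fut)
      hence "(habs (p - q * past n) * habs q) * habs (b n) < 1 * habs (b n)"
        using Nlt by (simp add: mult_ac)
      hence "habs (p - q * past n) * habs q < 1" using b1 by (simp only: mult_less_cancel_right_pos)
      hence "habs (p - q * past n) * habs ?b * habs p < 1"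
        by (simp add: mult_ac flip: pq)
      moreover have "habs (p - q * past n) * habs ?b * 1 \<le> habs (p - q * past n) * habs ?b * habs p"
        using p1 by (intro mult_left_mono) auto
      ultimately have "habs (p - q * past n) * habs ?b < 1" by linarith
      hence "habs (?b * (p - q * past n)) < 1" by (simp add: mult.commute)
      hence 1: "habs (?b * (p - q * past n)) < habs q" using p1 lt by linarith
      have "habs (q * past n * past (n - 1)) \<le> habs (q * past n) * 1"
        unfolding habs_mult[of "q * past n"]
        using habs_past_less_1[of "n - 1"] by (intro mult_left_mono) auto
      hence 2: "habs (q * past n * past (n - 1)) < habs q" using 4 lt by linarith
      \<comment> \<open>This relation rewrites the new entry \<open>?b * p + q\<close> as the small
        quantity \<open>?b * (p - q * past n)\<close> plus a multiple of two small pasts.\<close>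
      have "past (n - 1) * past n = ?b * past n + 1"
        using past_step[of "n - 1"] past_nz[of n] by (simp add: distrib_right)
      hence "q * (past (n - 1) * past n) = q * (?b * past n + 1)" by simp
      hence "?b * p + q = ?b * (p - q * past n) + q * past n * past (n - 1)"
        by (simp add: algebra_simps)
      hence "habs (?b * p + q) < habs q" using habs_add_less[OF 1 2] by metis
      moreover have "?b * p + q \<in> Rpoly" using R b_Rpoly by blast
      moreover have "N (n - 1) (?b * p + q) p < 1" using Suc.prems(4) N_step[of "n - 1"] by simp
      ultimately have "reducible (n - 1) (?b * p + q) p"
        using R 4(1) less_le_trans[OF lt le(2)] less_le_trans[OF _ le(2)]
        by (intro Suc.IH) auto
      thus ?thesis by (rule reducible_backward)
    qed
  qed
  obtain d where d: "max (habs p) (habs q) < real CARD('a) ^ d"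
    using real_arch_pow[OF card_field_gt_1] by blast
  show ?thesis by (rule main[OF assms, of d]) (use d in simp_all)
qed

lemma b_le: "habs (b n) \<le> real CARD('a) ^ m"
proof -
  have "habs (b n) * 1 \<le> habs (b n) * habs (b (n + 1))"
    using b_gt_1[of "n + 1"] by (intro mult_left_mono) auto
  thus ?thesis using b_bound[of n] by linarith
qed

text \<open>A value below 1 is moved to the cusp at infinity, where it equals |P|^2 /
  \<open>habs (b k)\<close> for a nonzero polynomial P; and a single letter has degree at most m
  because its neighbour is nonconstant.\<close>

lemma N_lower_bound:
  assumes "p \<in> Rpoly" "q \<in> Rpoly" "p \<noteq> 0 \<or> q \<noteq> 0"
  shows "N n p q \<ge> 1 / real CARD('a) ^ m"
proof (cases "N n p q < 1")
  case False
  moreover have "1 / real CARD('a) ^ m \<le> 1"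
    using card_field_gt_1[where 'a='a] by (simp add: divide_le_eq)
  ultimately show ?thesis by linarith
next
  case True
  from reducible_if_N_less_1[OF assms this] obtain k u v w z where *: "pgl2R u v w z"
    "w * p + z * q = 0" "\<And>r s. N n r s = N k (u * r + v * s) (w * r + z * s)"
    unfolding reducible_def by blast
  let ?p = "u * p + v * q"
  have R: "u \<in> Rpoly" "v \<in> Rpoly" using * by (auto simp: pgl2R_def)
  have nz: "u * z - v * w \<noteq> 0" using pgl2R_habs_det[OF *(1)] by auto
  have "?p \<noteq> 0"
  proof
    assume 0: "?p = 0"
    have "(u * z - v * w) * p = z * ?p - v * (w * p + z * q)"
      "(u * z - v * w) * q = u * (w * p + z * q) - w * ?p" by (simp_all add: algebra_simps)
    thus False using assms(3) nz unfolding 0 *(2) by simp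
  qed
  hence "habs ?p \<ge> 1" using R assms by (intro Rpoly_habs_ge_1) auto
  hence "1 * 1 \<le> habs ?p * habs ?p" by (intro mult_mono) auto
  hence "1 / real CARD('a) ^ m \<le> habs ?p * habs ?p / habs (b k)"
    using b_le[of k] b_gt_1[of k] by (intro frac_le) auto
  also have "\<dots> = N k ?p 0" by (simp add: N_eq)
  also have "\<dots> = N n p q" unfolding *(2)[symmetric] *(3) ..
  finally show ?thesis .
qed

text \<open>Moving the column of value below 1 to infinity makes the matrix upper triangular with
  constant diagonal. That value becomes 1 / \<open>habs (b k)\<close>, and the other is at least 1
  or at least the inverse size of a neighbouring letter, so \<open>b_bound\<close> applies to the
  product.\<close>

lemma N_pair_lower_bound:
  assumes "pgl2R p r q s"
  shows "N n p q * N n r s \<ge> 1 / real CARD('a) ^ m"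
proof -
  have main: "N n p q * N n r s \<ge> 1 / real CARD('a) ^ m"
    if g: "pgl2R p r q s" and less: "N n p q < 1" for p q r s
  proof -
    have R: "p \<in> Rpoly" "q \<in> Rpoly" "r \<in> Rpoly" "s \<in> Rpoly" using g by (auto simp: pgl2R_def)
    have "p \<noteq> 0 \<or> q \<noteq> 0" using pgl2R_habs_det[OF g] by auto
    from reducible_if_N_less_1[OF R(1,2) this less] obtain k u v w z where *: "pgl2R u v w z"
      "w * p + z * q = 0" "\<And>r s. N n r s = N k (u * r + v * s) (w * r + z * s)"
      unfolding reducible_def by blast
    define P where "P = u * p + v * q"
    define A where "A = u * r + v * s"
    define S where "S = w * r + z * s"
    from pgl2R_mult[OF *(1) g] have g': "pgl2R P A 0 S" unfolding *(2) P_def A_def S_def .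
    hence "habs P * habs S = 1" "P \<noteq> 0" "S \<noteq> 0" "P \<in> Rpoly" "S \<in> Rpoly" "A \<in> Rpoly"
      using pgl2R_habs_det[OF g'] by (auto simp: pgl2R_def)
    moreover from this have "habs P \<ge> 1" "habs S \<ge> 1" by (auto intro: Rpoly_habs_ge_1)
    \<comment> \<open>Two polynomials of size at least 1 with product of size 1 are both
      constants.\<close>
    ultimately have PS: "habs P = 1" "habs S = 1" "A \<in> Rpoly" "S \<in> Rpoly"
      using mult_mono[of 1 "habs P" "habs S" "habs S"] mult_mono[of "habs P" "habs P" 1 "habs S"] by auto
    have bk: "habs (b k) > 1" by (rule b_gt_1)
    have "N n p q = N k P 0" unfolding P_def *(2)[symmetric] by (rule *(3))
    hence NP: "N n p q = 1 / habs (b k)" by (simp add: N_eq[of k] PS)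
    have NS: "N n r s = N k A S" unfolding A_def S_def by (rule *(3))
    show ?thesis
    proof (cases "N k A S \<ge> 1")
      case True
      have "1 / real CARD('a) ^ m \<le> 1 / habs (b k)"
        using b_le[of k] bk by (intro divide_left_mono) auto
      also have "\<dots> \<le> 1 / habs (b k) * N k A S"
        using mult_left_mono[OF True, of "1 / habs (b k)"] by simp
      finally show ?thesis unfolding NP NS .
    next
      case False
      have S0: "S \<noteq> 0" using PS by auto
      have "A = 0 \<or> habs A = habs (S * fut k) \<or> habs A = habs (S * past k)"
        using N_ge_1[OF PS(3) _ PS(4) S0] False by auto
      moreover have "A = 0" if "habs A = habs (S * past k)"
        using that PS habs_past_less_1[of k] by (intro Rpoly_habs_less_1) auto
      ultimately consider "A = 0" | "habs A = habs (S * fut k)" by blast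
      thus ?thesis
      proof cases
        case 1
        have "1 / real CARD('a) ^ m \<le> 1 / (habs (b (k - 1)) * habs (b (k - 1 + 1)))"
          using b_bound[of "k - 1"] b_gt_1[of "k - 1"] bk
          by (intro divide_left_mono mult_pos_pos) auto
        also have "\<dots> = N n p q * N n r s"
          using less_trans[OF zero_less_one bk] unfolding NP NS by (simp add: N_eq 1 PS habs_fut habs_past)
        finally show ?thesis .
      next
        case 2
        have "habs (S * past k) < habs A" using 2 PS bk habs_past_less_1[of k] by (simp add: habs_fut)
        hence A: "habs (A - S * past k) = habs (b k)" using 2 PS by (simp add: habs_diff_eq_left habs_fut)
        \<comment> \<open>Split into polynomial and fractional part: a nonzero polynomial part
          dominates, and otherwise only the fractional part, of size 1 /
          \<open>habs (b (k + 1))\<close>, remains.\<close>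
        have eq: "A - S * fut k = (A - S * b k) - S / fut (k + 1)"
          using fut_step[of k] by (simp add: algebra_simps)
        have lt: "habs (S / fut (k + 1)) < 1"
          using b_gt_1[of "k + 1"] PS by (simp add: habs_fut divide_less_eq)
        have "habs (A - S * fut k) \<ge> habs (S / fut (k + 1))"
        proof (cases "A - S * b k = 0")
          case False
          have "A - S * b k \<in> Rpoly" using PS b_Rpoly by blast
          hence "habs (A - S * b k) \<ge> 1" using False by (rule Rpoly_habs_ge_1)
          hence "habs (S / fut (k + 1)) < habs (A - S * b k)" using lt by linarith
          thus ?thesis unfolding eq by (simp only: habs_diff_eq_left)
        qed (simp only: eq diff_0 habs_minus)
        hence ge: "habs (A - S * fut k) \<ge> 1 / habs (b (k + 1))" using PS by (simp add: habs_fut)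
        have "1 / real CARD('a) ^ m \<le> 1 / (habs (b k) * habs (b (k + 1)))"
          using b_bound[of k] b_gt_1[of "k + 1"] bk
          by (intro divide_left_mono mult_pos_pos) auto
        also have "\<dots> = 1 / habs (b k) * (1 / habs (b (k + 1)))" by simp
        also have "\<dots> \<le> 1 / habs (b k) * habs (A - S * fut k)"
          using ge by (intro mult_left_mono) auto
        also have "\<dots> = N n p q * N n r s"
          using less_trans[OF zero_less_one bk] unfolding NP NS by (simp add: N_eq A)
        finally show ?thesis .
      qed
    qed
  qed
  show ?thesis
  proof (cases "N n p q < 1 \<or> N n r s < 1")
    case True
    \<comment> \<open>The statement is symmetric in the columns; the swap only changes the sign of
      the determinant.\<close>
    have "pgl2R r p s q"
    proof -
      obtain u where u: "u \<noteq> 0" "p * s - r * q = fls_const u" using assms by (auto simp: pgl2R_def)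
      have "r * q - p * s = - (p * s - r * q)" by simp
      also have "\<dots> = fls_const (- u)" unfolding u(2) by simp
      finally show ?thesis using assms u(1) unfolding pgl2R_def by (intro conjI exI[of _ "- u"]) auto
    qed
    thus ?thesis using True main[OF assms] main[of r p s q] by (auto simp: mult.commute)
  next
    case False
    hence "1 * 1 \<le> N n p q * N n r s" by (intro mult_mono) auto
    moreover have "1 / real CARD('a) ^ m \<le> 1"
      using card_field_gt_1[where 'a='a] by (simp add: divide_le_eq)
    ultimately show ?thesis by linarith
  qed
qed

lemma shallow_fut_past: "shallow m (fut n) (past n)"
  unfolding shallow_def using N_lower_bound N_pair_lower_bound by blast

text \<open>The convergent matrix of one period fixes both \<open>fut 0\<close> and
  \<open>past 0\<close>. They are thus roots of the same quadratic, distinct since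
  |\<open>past 0\<close>| < 1 < |\<open>fut 0\<close>|, and Vieta gives trace and norm.\<close>

lemma periodic_Kconj:
  assumes periodic: "\<And>n. b (n + int (Suc l)) = b n"
  shows "Kconj (fut 0) (past 0)"
proof -
  let ?P = "convP (\<lambda>i. b (int i))" and ?Q = "convQ (\<lambda>i. b (int i))"
  interpret e: cf_expansion "\<lambda>i. fut (int i)" "\<lambda>i. b (int i)"
    using cf_expansion_fut[of 0] by simp
  have fut_l: "fut (int (Suc l)) = fut 0"
    unfolding fut_def using periodic by (simp add: add.commute)
  have "b (int (Suc l) - 1 - int i) = b (- 1 - int i)" for i
    using periodic[of "- 1 - int i"] by (simp add: algebra_simps)
  hence past_l: "past (int (Suc l)) = past 0" unfolding past_def by simp
  define A where "A = ?Q (Suc l)"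
  define B where "B = ?Q l - ?P (Suc l)"
  define C where "C = - ?P l"
  have R: "A \<in> Rpoly" "B \<in> Rpoly" "C \<in> Rpoly"
    unfolding A_def B_def C_def by (intro Rpoly_diff Rpoly_minus conv_Rpoly b_Rpoly)+
  have A: "A \<noteq> 0" unfolding A_def by (rule e.Q_nz)
  define x where "x = fut 0"
  define y where "y = past 0"
  have "x * (?Q (Suc l) * x + ?Q l) = ?P (Suc l) * x + ?P l"
    using e.x_0_mult[of l] unfolding x_def fut_l by simp
  hence fx: "A * x * x + B * x + C = 0" unfolding A_def B_def C_def by (simp add: algebra_simps)
  have "past 0 * (?Q (Suc l) * past (int (Suc l)) + ?Q l) = ?P (Suc l) * past (int (Suc l)) + ?P l"
  proof -
    have "past (int i) = b (int i) + 1 / past (int (Suc i))" for i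
      using past_step[of "int i"] by (simp add: add.commute)
    from conv_complete_quotient[of "\<lambda>i. past (int i)" "\<lambda>i. b (int i)", OF this past_nz]
    show ?thesis by simp
  qed
  hence fy: "A * y * y + B * y + C = 0"
    unfolding past_l y_def A_def B_def C_def by (simp add: algebra_simps)
  have neq: "x \<noteq> y"
    using habs_fut[of 0] b_gt_1[of 0] habs_past_less_1[of 0] unfolding x_def y_def by auto
  have "(A * (x + y) + B) * (x - y) = (A * x * x + B * x + C) - (A * y * y + B * y + C)"
    by (simp add: algebra_simps)
  hence 0: "A * (x + y) + B = 0" using neq unfolding fx fy by simp
  hence sum: "x + y = - B / A" using A by (simp add: field_simps eq_neg_iff_add_eq_0)
  have "A * (x * y) - C = x * (A * (x + y) + B) - (A * x * x + B * x + C)"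
    by (simp add: algebra_simps)
  hence prod: "x * y = C / A" unfolding 0 fx using A by (simp add: field_simps)
  show ?thesis
    using sum prod R A fut_notin_Kfield[of 0] past_notin_Kfield[of 0]
    unfolding Kconj_def x_def y_def by (auto intro: KfieldI[of "- B" A] KfieldI[of C A])
qed

end

section \<open>The lower bound\<close>

lemma max_mult_max_less:
  fixes a :: real
  assumes "a * c < k" "a * d < k" "b * c < k" "b * d < k"
  shows "max a b * max c d < k"
  using assms by (auto simp: max_def)

text \<open>To be read with A, B the sizes of consecutive denominators of f, r = |f - \<beta>|, R
  the distance from f to the conjugate of \<beta> and c = q^-m. The maxima bound the two linear
  factors of the norm value at a convergent.\<close>

lemma max_mult_max_less_1:
  fixes A B P r R c :: real
  assumes "A > 0" "B > 0" "R > 0" "r \<ge> 0" "c \<le> 1" "A < c * B" "r < c * R" "1 < B\<^sup>2 * r" "A\<^sup>2 * R < 1"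
  shows "max (1 / B) (A * r) * max (1 / B) (A * R) < c * R"
proof (rule max_mult_max_less)
  have c: "c > 0" using zero_less_mult_pos2[of c B] assms by linarith
  have r: "r > 0" using assms by (cases "r = 0") auto
  show "1 / B * (1 / B) < c * R"
  proof -
    have "1 / B * (1 / B) < r" using assms by (simp add: field_simps power2_eq_square)
    thus ?thesis using assms by linarith
  qed
  show "1 / B * (A * R) < c * R" using assms by (simp add: field_simps)
  show "A * r * (1 / B) < c * R"
  proof -
    have "A * r < c * B * r" using assms r by (intro mult_strict_right_mono)
    also have "\<dots> \<le> 1 * B * r" using assms by (intro mult_right_mono) auto
    finally have "A * r * (1 / B) < r" using assms by (simp add: field_simps)
    thus ?thesis using assms by linarith
  qed
  show "A * r * (A * R) < c * R"
  proof -
    have "A\<^sup>2 * R * r < 1 * r" using assms r by (intro mult_strict_right_mono)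
    hence "A * r * (A * R) < r" by (simp add: power2_eq_square mult_ac)
    thus ?thesis using assms by linarith
  qed
qed

text \<open>Same reading, with P, A, B three consecutive denominator sizes. Since 1/A lies between A
  r and A R, two of the four maxima are determined and their product is R; one product of two maxima
  remains to be estimated.\<close>

lemma max_mult_max_less_2:
  fixes A B P r R c :: real
  assumes "A > 0" "B > 0" "P > 0" "R > 0" "r \<ge> 0" "c \<le> 1" "A < c * B" "P < c * A"
    "r < c * R" "A\<^sup>2 * r \<le> 1" "1 \<le> A\<^sup>2 * R"
  shows "(max (1 / B) (A * r) * max (1 / B) (A * R) / R) * (max (1 / A) (P * r) * max (1 / A) (P * R) / R) < c"
proof -
  have c: "c > 0" using zero_less_mult_pos2[of c B] assms by linarith
  have AB: "A < B" using mult_right_mono[of c 1 B] assms by linarith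
  have PA: "P < A" using mult_right_mono[of c 1 A] assms by linarith
  have "1 / B \<le> 1 / A" using AB assms by (simp add: field_simps)
  also have "\<dots> \<le> A * R" using assms by (simp add: field_simps power2_eq_square)
  finally have 1: "max (1 / B) (A * R) = A * R" by simp
  have "P * r \<le> A * r" using PA assms by (intro mult_right_mono) auto
  also have "\<dots> \<le> 1 / A" using assms by (simp add: field_simps power2_eq_square)
  finally have 2: "max (1 / A) (P * r) = 1 / A" by simp
  have "max (1 / B) (A * r) * max (1 / A) (P * R) < c * R"
  proof (rule max_mult_max_less)
    have "A\<^sup>2 * R * 1 < A\<^sup>2 * R * (c * B / A)"
      using assms by (intro mult_strict_left_mono) (auto simp: field_simps)
    hence "1 < A\<^sup>2 * R * (c * B / A)" using assms by linarith
    thus "1 / B * (1 / A) < c * R" using assms by (simp add: field_simps power2_eq_square)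
    have "P < c * B" using PA assms by linarith
    thus "1 / B * (P * R) < c * R" using assms by (simp add: field_simps)
    show "A * r * (1 / A) < c * R" using assms by simp
    have "A\<^sup>2 * r * P \<le> 1 * P" using assms by (intro mult_right_mono) auto
    hence "A\<^sup>2 * r * P < c * A" using assms by linarith
    hence "A * r * P < c" using assms by (simp add: field_simps power2_eq_square)
    thus "A * r * (P * R) < c * R" using assms by simp
  qed
  moreover have "(max (1 / B) (A * r) * max (1 / B) (A * R) / R) * (max (1 / A) (P * r) * max (1 / A) (P * R) / R)
     = max (1 / B) (A * r) * max (1 / A) (P * R) / R"
    unfolding 1 2 using assms by simp
  ultimately show ?thesis using assms by (simp add: divide_less_eq)
qed

lemma shallowD:
  assumes "shallow m x (y::'a::{field,finite} fls)"
  shows "p \<in> Rpoly \<Longrightarrow> q \<in> Rpoly \<Longrightarrow> q \<noteq> 0 \<Longrightarrow> fval x y p q \<ge> 1 / real CARD('a) ^ m"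
    and "pgl2R p r q s \<Longrightarrow> fval x y p q * fval x y r s \<ge> 1 / real CARD('a) ^ m"
  using assms unfolding shallow_def by blast+

section \<open>Elements with large partial quotients stay away from shallow pairs\<close>

context cf_expansion
begin

lemma habs_conv_diff_le:
  "habs (P (Suc n) - Q (Suc n) * y) \<le> max (1 / habs (Q (Suc (Suc n)))) (habs (Q (Suc n)) * habs (x 0 - y))"
proof -
  have eq: "P (Suc n) - Q (Suc n) * y = (P (Suc n) - Q (Suc n) * x 0) + Q (Suc n) * (x 0 - y)"
    by (simp add: algebra_simps)
  show ?thesis
    using habs_add_le[of "P (Suc n) - Q (Suc n) * x 0" "Q (Suc n) * (x 0 - y)"]
    unfolding eq approximation habs_mult[of "Q (Suc n)"] .
qed

lemma fval_conv_le:
  "fval y z (P (Suc n)) (Q (Suc n)) \<le>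
    max (1 / habs (Q (Suc (Suc n)))) (habs (Q (Suc n)) * habs (x 0 - y)) *
    max (1 / habs (Q (Suc (Suc n)))) (habs (Q (Suc n)) * habs (x 0 - z)) / habs (y - z)"
  unfolding fval_def by (intro divide_right_mono mult_mono habs_conv_diff_le) (auto simp: le_max_iff_disj)

text \<open>If \<open>x 0\<close> were \<open>y\<close>, one linear factor at a convergent would be
  at most 1/B and the other at most max(1/B, A R). As A/B < q^-m, the value falls below q^-m once B
  is large.\<close>

lemma shallow_neq:
  assumes big: "\<And>n. habs (a (Suc n)) > real CARD('a) ^ m"
    and sh: "shallow m y z" and "y \<noteq> z"
  shows "x 0 \<noteq> y"
proof
  assume xy: "x 0 = y"
  define c where "c = 1 / real CARD('a) ^ m"
  have c: "c > 0" by (simp add: c_def)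
  define R where "R = habs (y - z)"
  have R: "R > 0" using \<open>y \<noteq> z\<close> by (simp add: R_def)
  obtain N where N: "\<forall>n\<ge>N. habs (Q (Suc n)) > max 1 (1 / (c * R))"
    using Q_large by blast
  define A where "A = habs (Q (Suc N))"
  define B where "B = habs (Q (Suc (Suc N)))"
  have "A > 1" "B > 1 / (c * R)" "B > 1"
    using N[THEN spec, of N] N[THEN spec, of "Suc N"] by (simp_all only: A_def B_def) auto
  hence "1 / (c * R) * 1 < B * B" using c R by (intro mult_strict_mono) auto
  hence 1: "1 / B * (1 / B) < c * R" using c R \<open>B > 1\<close> by (simp add: field_simps)
  have "real CARD('a) ^ m * A < B"
    unfolding A_def B_def Q_habs_Suc using big[of N] Q_nz[of N] by (intro mult_strict_right_mono) auto
  hence "A < c * B" unfolding c_def by (simp add: field_simps)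
  hence 2: "1 / B * (A * R) < c * R" using R \<open>B > 1\<close> by (simp add: field_simps)
  have "fval y z (P (Suc N)) (Q (Suc N)) \<le> max (1 / B) (A * 0) * max (1 / B) (A * R) / R"
    using fval_conv_le[of y z N] unfolding xy A_def B_def R_def by simp
  also have "\<dots> < c"
    using max_mult_max_less[OF 1 2, of 0] c R by (simp add: divide_less_eq)
  finally have "fval y z (P (Suc N)) (Q (Suc N)) < c" .
  moreover have "fval y z (P (Suc N)) (Q (Suc N)) \<ge> c"
    unfolding c_def by (intro shallowD(1)[OF sh] conv_Rpoly a_Rpoly Q_nz)
  ultimately show False by simp
qed

lemma shallow_lower_bound:
  assumes big: "\<And>n. habs (a (Suc n)) > real CARD('a) ^ m"
    and sh: "shallow m y z" and "y \<noteq> z" and small: "habs (y - z) < 1"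
  shows "habs (x 0 - y) \<ge> habs (y - z) / real CARD('a) ^ m"
proof (rule ccontr)
  define c where "c = 1 / real CARD('a) ^ m"
  have c: "c > 0" "c \<le> 1" using card_field_gt_1[where 'a='a] by (simp_all add: c_def divide_le_eq)
  define r where "r = habs (x 0 - y)"
  define R where "R = habs (y - z)"
  have R: "R > 0" "R < 1" using \<open>y \<noteq> z\<close> small by (simp_all add: R_def)
  have r: "r > 0" using shallow_neq[OF big sh \<open>y \<noteq> z\<close>] by (simp add: r_def)
  assume "\<not> ?thesis"
  hence rR: "r < c * R" by (simp add: r_def R_def c_def)
  also have "\<dots> \<le> 1 * R" using c R by (intro mult_right_mono) auto
  finally have "r < R" by simp
  \<comment> \<open>Being closer to \<open>y\<close> than \<open>y\<close> is to \<open>z\<close>,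
    the point \<open>x 0\<close> has distance exactly \<open>R\<close> from
    \<open>z\<close>.\<close>
  hence xz: "habs (x 0 - z) = R"
    using habs_add_eq_right[of "x 0 - y" "y - z"] by (simp add: r_def R_def)
  define q where "q n = habs (Q (Suc n))" for n
  have q0: "q 0 = 1" by (simp add: q_def)
  have qpos: "q n > 0" for n using Q_nz[of n] by (simp add: q_def)
  have qstep: "q n < c * q (Suc n)" for n
  proof -
    have "real CARD('a) ^ m * q n < q (Suc n)"
      unfolding q_def Q_habs_Suc using big[of n] Q_nz[of n] by (intro mult_strict_right_mono) auto
    thus ?thesis unfolding c_def by (simp add: field_simps)
  qed
  define F where "F n = fval y z (P (Suc n)) (Q (Suc n))" for n
  have F: "F n \<le> max (1 / q (Suc n)) (q n * r) * max (1 / q (Suc n)) (q n * R) / R" for n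
    using fval_conv_le[of y z n] unfolding F_def q_def r_def xz R_def .
  have F_ge: "F n \<ge> c" for n
    unfolding c_def F_def by (intro shallowD(1)[OF sh] conv_Rpoly a_Rpoly Q_nz)
  have FF_ge: "F (Suc n) * F n \<ge> c" for n
    unfolding c_def F_def by (intro shallowD(2)[OF sh] conv_pgl2R a_Rpoly)
  have "\<exists>n. 1 < (q (Suc n))\<^sup>2 * r"
  proof -
    obtain N where N: "\<forall>n\<ge>N. habs (Q (Suc n)) > max 1 (1 / r)" using Q_large by blast
    have "q (Suc N) > 1" "q (Suc N) > 1 / r"
      using N[THEN spec, of "Suc N"] by (simp_all add: q_def del: convQ.simps)
    hence "1 * (1 / r) < q (Suc N) * q (Suc N)" using r by (intro mult_strict_mono) auto
    thus ?thesis using r by (intro exI[of _ N]) (simp add: field_simps power2_eq_square)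
  qed
  \<comment> \<open>\<open>k\<close> is the first index at which the next denominator resolves the
    gap r between \<open>x 0\<close> and \<open>y\<close>; minimality supplies the inequality A^2 r
    \<le> 1 for the pair.\<close>
  then obtain k where k: "1 < (q (Suc k))\<^sup>2 * r" and least: "\<And>n. n < k \<Longrightarrow> \<not> 1 < (q (Suc n))\<^sup>2 * r"
    using exists_least_iff[of "\<lambda>n. 1 < (q (Suc n))\<^sup>2 * r"] by blast
  \<comment> \<open>In the first case the \<open>k\<close>-th convergent alone gives the contradiction, otherwise a pair does.\<close>
  show False
  proof (cases "(q k)\<^sup>2 * R < 1")
    case True
    have "max (1 / q (Suc k)) (q k * r) * max (1 / q (Suc k)) (q k * R) < c * R"
      by (rule max_mult_max_less_1) (use qpos R r c rR qstep k True in auto)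
    hence "max (1 / q (Suc k)) (q k * r) * max (1 / q (Suc k)) (q k * R) / R < c"
      using R by (simp add: divide_less_eq)
    thus False using F[of k] F_ge[of k] by linarith
  next
    case False
    \<comment> \<open>The hypothesis \<open>small\<close> guarantees a preceding convergent: at
      index 0 the denominator is 1, while R < 1.\<close>
    hence "k \<noteq> 0" using q0 R by (metis mult_1 one_power2)
    then obtain j where j: "k = Suc j" using not0_implies_Suc by blast
    have "F (Suc j) * F j \<le>
      (max (1 / q (Suc k)) (q k * r) * max (1 / q (Suc k)) (q k * R) / R)
      * (max (1 / q k) (q j * r) * max (1 / q k) (q j * R) / R)"
      using F[of k] F[of j] unfolding j by (intro mult_mono) (auto simp: F_def intro: order_trans[OF fval_nonneg])
    also have "\<dots> < c"
      by (rule max_mult_max_less_2) (use qpos R r c rR qstep[of j] qstep[of k] j k False least[of j] in auto)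
    finally show False using FF_ge[of j] by linarith
  qed
qed

end

section \<open>The upper bound\<close>

lemma habs_eq_power:
  assumes "habs (f::'a::{field,finite} fls) \<ge> 1"
  obtains d where "habs f = real CARD('a) ^ d"
proof -
  have "f \<noteq> 0" using assms by auto
  hence f: "habs f = real CARD('a) powi (- fls_subdegree f)" by (simp add: habs_def)
  hence "real CARD('a) powi 0 \<le> real CARD('a) powi (- fls_subdegree f)" using assms by simp
  hence "0 \<le> - fls_subdegree f" unfolding card_powi_le_iff .
  hence "habs f = real CARD('a) ^ nat (- fls_subdegree f)" unfolding f by (simp add: power_int_def)
  thus thesis by (rule that)
qed

lemma finite_Rpoly_habs_le: "finite {f \<in> Rpoly. habs (f::'a::{field,finite} fls) \<le> real CARD('a) ^ d}"
proof (rule inj_on_finite)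
  let ?h = "\<lambda>f::'a fls. \<lambda>i\<in>{..d}. fls_nth f (- int i)"
  show "finite ({..d} \<rightarrow>\<^sub>E (UNIV :: 'a set))" by (intro finite_PiE) auto
  show "?h ` {f \<in> Rpoly. habs f \<le> real CARD('a) ^ d} \<subseteq> {..d} \<rightarrow>\<^sub>E UNIV"
    by (auto split: if_splits)
  show "inj_on ?h {f \<in> Rpoly. habs f \<le> real CARD('a) ^ d}"
  proof (rule inj_onI)
    fix f g :: "'a fls"
    assume f: "f \<in> {f \<in> Rpoly. habs f \<le> real CARD('a) ^ d}"
      and g: "g \<in> {f \<in> Rpoly. habs f \<le> real CARD('a) ^ d}" and eq: "?h f = ?h g"
    have zero: "fls_nth h k = 0" if "h \<in> {f \<in> Rpoly. habs f \<le> real CARD('a) ^ d}" "k < - int d \<or> k > 0"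
      for h :: "'a fls" and k
      using that habs_le_powi_iff[of h "- int d"] by (auto simp: Rpoly_def)
    have "fls_nth f k = fls_nth g k" for k
    proof (cases "k < - int d \<or> k > 0")
      case True
      thus ?thesis using zero[OF f] zero[OF g] by simp
    next
      case False
      hence "nat (- k) \<le> d" "- int (nat (- k)) = k" by auto
      thus ?thesis using fun_cong[OF eq, of "nat (- k)"] by simp
    qed
    thus "f = g" by (intro fls_eqI)
  qed
qed

text \<open>Words have the m + 1 letters with index at most m. The bound m - 1 on degrees leaves
  room for a neighbour of degree 1 and makes the set of words finite.\<close>

definition admissible :: "nat \<Rightarrow> (nat \<Rightarrow> 'a::{field,finite} fls) \<Rightarrow> bool" where
  "admissible m w \<longleftrightarrow>
     (\<forall>i\<le>m. w i \<in> Rpoly \<and> habs (w i) > 1 \<and> habs (w i) \<le> real CARD('a) ^ (m - 1)) \<and>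
     (\<forall>i<m. habs (w i) * habs (w (Suc i)) \<le> real CARD('a) ^ m)"

text \<open>All admissible words are concatenated cyclically. The separator Y of degree 1 may stand
  next to any letter, since letters have degree at most m - 1.\<close>

lemma universal_sequence:
  assumes m: "m \<ge> 2"
  shows "\<exists>(b::int \<Rightarrow> 'a::{field,finite} fls) l. bi_cf b m \<and> (\<forall>n. b (n + int (Suc l)) = b n) \<and>
    (\<forall>w. admissible m w \<longrightarrow> (\<exists>j. \<forall>i\<le>m. b (j + int i) = w i))"
proof -
  define q where "q = real CARD('a)"
  have q: "q > 1" unfolding q_def by (rule card_field_gt_1)
  define Y :: "'a fls" where "Y = fls_X_inv"
  have Y: "Y \<in> Rpoly" "habs Y = q"
    unfolding Y_def q_def by simp_all
  define W where "W = {w \<in> {..m} \<rightarrow>\<^sub>E {f \<in> Rpoly. habs (f::'a fls) \<le> real CARD('a) ^ (m - 1)}. admissible m w}"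
  have "finite W" unfolding W_def
    by (rule finite_subset[OF Collect_restrict]) (intro finite_PiE finite_atMost finite_Rpoly_habs_le)
  then obtain e where e: "bij_betw e {0..<card W} W" using ex_bij_betw_nat_finite by blast
  have restrict_W: "restrict w {..m} \<in> W" if "admissible m w" for w
    using that by (auto simp: W_def admissible_def)
  have qm: "q * q ^ (m - 1) = q ^ m" using m by (simp flip: power_Suc)
  have q_le: "q \<le> q ^ (m - 1)" using q m by (simp add: self_le_power)
  have "admissible m (\<lambda>_. Y)"
    using Y q q_le qm mult_left_mono[OF q_le, of q] by (simp add: admissible_def flip: q_def)
  hence "W \<noteq> {}" using restrict_W by blast
  define K where "K = card W"
  have K: "K > 0" using \<open>W \<noteq> {}\<close> \<open>finite W\<close> by (simp add: K_def card_gt_0_iff)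
  define M where "M = int (m + 2)"
  have M: "M > 0" by (simp add: M_def)
  \<comment> \<open>Blocks of length \<open>M\<close>: the separator \<open>Y\<close> followed by one of the \<open>K\<close> admissible words.\<close>
  define r where "r n = nat (n div M mod int K)" for n
  define b where "b n = (if n mod M = 0 then Y else e (r n) (nat (n mod M - 1)))" for n
  have e_W: "e (r n) \<in> W" for n
  proof -
    have "r n < K" using K by (simp add: r_def nat_less_iff)
    thus ?thesis using e by (auto simp: K_def bij_betw_def)
  qed
  hence adm: "admissible m (e (r n))" for n by (simp add: W_def)
  have idx: "nat (n mod M - 1) \<le> m" for n
  proof -
    have "n mod M < M" using M by simp
    moreover have "M = int m + 2" by (simp add: M_def)
    ultimately show ?thesis by linarith
  qed
  have b_props: "b n \<in> Rpoly \<and> habs (b n) > 1 \<and> habs (b n) \<le> q ^ (m - 1)" for n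
    using adm[of n] idx[of n] Y q q_le by (auto simp: b_def admissible_def simp flip: q_def)
  have bound: "habs (b n) * habs (b (n + 1)) \<le> q ^ m" for n
  proof (cases "b n = Y \<or> b (n + 1) = Y")
    case True
    have "q * habs (b k) \<le> q * q ^ (m - 1)" for k
      using b_props[of k] q by (intro mult_left_mono) auto
    thus ?thesis using True Y qm by (auto simp: mult.commute)
  next
    case False
    \<comment> \<open>Neither position is a separator, so both lie in the same block and hold
      consecutive letters of one word.\<close>
    hence n: "n mod M \<noteq> 0" "(n + 1) mod M \<noteq> 0" by (auto simp: b_def)
    have s: "0 \<le> n mod M" "n mod M < M" using M by simp_all
    have decomp: "n + 1 = M * (n div M) + (n mod M + 1)"
      using mult_div_mod_eq[of M n] by linarith
    have "n mod M \<noteq> M - 1"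
    proof
      assume "n mod M = M - 1"
      hence "(n + 1) mod M = 0" using mod_add_left_eq[of n M 1] by simp
      thus False using n by simp
    qed
    hence lt: "n mod M + 1 < M" using s by simp
    have md: "(n + 1) mod M = n mod M + 1"
      by (rule int_mod_pos_eq[OF decomp]) (use lt s in simp_all)
    have dv: "(n + 1) div M = n div M"
      by (rule int_div_pos_eq[OF decomp]) (use lt s in simp_all)
    have r: "r (n + 1) = r n" by (simp add: r_def dv)
    define i where "i = nat (n mod M - 1)"
    have "n mod M > 0" using n s by simp
    hence i: "nat ((n + 1) mod M - 1) = Suc i" "i < m"
    proof -
      have *: "nat (x + 1 - 1) = Suc (nat (x - 1)) \<and> nat (x - 1) < m" if "0 < x" "x + 1 < int m + 2" for x
        using that by linarith
      have "M = int m + 2" by (simp add: M_def)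
      thus "nat ((n + 1) mod M - 1) = Suc i" "i < m"
        using *[OF \<open>n mod M > 0\<close>] lt unfolding md i_def by simp_all
    qed
    show ?thesis using adm[of n] i n
      by (simp add: b_def r admissible_def flip: i_def q_def)
  qed
  have bi: "bi_cf b m"
    using b_props bound by unfold_locales (auto simp flip: q_def)
  obtain l where l: "(m + 2) * K = Suc l" using K by (cases "(m + 2) * K") auto
  have lM: "int (Suc l) = M * int K" unfolding l[symmetric] M_def by (rule of_nat_mult)
  have "b (n + int (Suc l)) = b n" for n
    unfolding lM b_def r_def using M by (simp add: mod_add_self2)
  moreover have "\<exists>j. \<forall>i\<le>m. b (j + int i) = w i" if w: "admissible m w" for w
  proof -
    obtain t where t: "t < K" "e t = restrict w {..m}"
      using restrict_W[OF w] e unfolding K_def bij_betw_def by (metis atLeastLessThan_iff imageE)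
    have "b (int t * M + 1 + int i) = w i" if "i \<le> m" for i
    proof -
      have eq: "int t * M + 1 + int i = M * int t + (1 + int i)" by simp
      have lt: "0 \<le> 1 + int i" "1 + int i < M" using that by (simp_all add: M_def)
      have md: "(int t * M + 1 + int i) mod M = 1 + int i"
        by (rule int_mod_pos_eq[OF eq]) (use lt in simp_all)
      have "(int t * M + 1 + int i) div M = int t"
        by (rule int_div_pos_eq[OF eq]) (use lt in simp_all)
      hence "r (int t * M + 1 + int i) = t" using t(1) by (simp add: r_def)
      thus ?thesis unfolding b_def md using t(2) that by simp
    qed
    thus ?thesis by blast
  qed
  ultimately show ?thesis using bi by blast
qed

text \<open>A shift by one place is a homography of determinant -1, the same for both ends, so all
  shifts stay in one orbit together with their conjugates.\<close>

lemma (in bi_cf) fut_past_orbit: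
  "\<exists>p q r s. pgl2R p q r s \<and> fut n = homog p q r s (fut 0) \<and> past n = homog p q r s (past 0)"
proof (induction n rule: int_induct[where k = 0])
  case base
  show ?case
    by (rule exI[of _ 1], rule exI[of _ 0], rule exI[of _ 0], rule exI[of _ 1])
      (auto simp: homog_def pgl2R_def intro: exI[of _ 1])
next
  case (step1 n)
  then obtain p q r s where g: "pgl2R p q r s" "fut n = homog p q r s (fut 0)" "past n = homog p q r s (past 0)"
    by blast
  have h: "pgl2R 0 1 1 (- b n)"
    by (auto simp: pgl2R_def b_Rpoly intro!: exI[of _ "- 1"])
  have "fut (n + 1) = homog 0 1 1 (- b n) (fut n)"
    using fut_step[of n] by (simp add: homog_def)
  moreover have "past (n + 1) = homog 0 1 1 (- b n) (past n)"
    using past_step[of n] by (simp add: homog_def)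
  ultimately show ?case
    using pgl2R_mult[OF h g(1)] homog_homog[OF g(1) fut_notin_Kfield] homog_homog[OF g(1) past_notin_Kfield]
    unfolding g(2,3) by metis
next
  case (step2 n)
  then obtain p q r s where g: "pgl2R p q r s" "fut n = homog p q r s (fut 0)" "past n = homog p q r s (past 0)"
    by blast
  have h: "pgl2R (b (n - 1)) 1 1 0"
    by (auto simp: pgl2R_def b_Rpoly intro!: exI[of _ "- 1"])
  have "fut (n - 1) = homog (b (n - 1)) 1 1 0 (fut n)"
    using fut_step[of "n - 1"] fut_nz[of n] by (simp add: homog_def add_divide_distrib)
  moreover have "past (n - 1) = homog (b (n - 1)) 1 1 0 (past n)"
    using past_step[of "n - 1"] past_nz[of n] by (simp add: homog_def add_divide_distrib)
  ultimately show ?case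
    using pgl2R_mult[OF h g(1)] homog_homog[OF g(1) fut_notin_Kfield] homog_homog[OF g(1) past_notin_Kfield]
    unfolding g(2,3) by metis
qed

text \<open>Letters differing by a nonzero constant force a known distance between the pasts one
  place later; this separates the conjugates of two matches.\<close>

lemma (in bi_cf) habs_past_diff:
  assumes "habs (b i - b j) = 1"
  shows "habs (past (i + 1) - past (j + 1)) = 1 / (habs (b i) * habs (b j))"
proof -
  have h: "habs (b k - past k) = habs (b k)" for k
    using habs_past_less_1[of k] b_gt_1[of k] by (intro habs_diff_eq_left) simp
  hence nz: "b k - past k \<noteq> 0" for k using b_nz[of k] by (metis habs_eq_0_iff)
  have "habs (past i - past j) < 1" by (intro habs_diff_less habs_past_less_1)
  hence "habs ((b i - b j) - (past i - past j)) = 1" using assms by (simp add: habs_diff_eq_left)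
  moreover have "past (i + 1) - past (j + 1)
      = ((b i - b j) - (past i - past j)) / ((b i - past i) * (b j - past j))"
    unfolding past_step' using nz[of i] nz[of j] by (simp add: field_simps)
  ultimately show ?thesis by (simp only: habs_divide habs_mult h)
qed

text \<open>Every shared partial quotient contracts by at least q^2. A factor q per letter is
  enough: a word of m + 1 letters supplies m shared ones after its first.\<close>

lemma cf_expansion_common_prefix:
  assumes "cf_expansion x a" "cf_expansion y c"
    and "\<And>i. i < L \<Longrightarrow> a (Suc (n + i)) = c (Suc (k + i))"
  shows "habs (1 / x (Suc n) - 1 / y (Suc k) :: 'a::{field,finite} fls) \<le> 1 / real CARD('a) ^ L"
  using assms(3)
proof (induction L arbitrary: n k)
  case 0
  have "habs (1 / x (Suc n)) < 1" "habs (1 / y (Suc k)) < 1"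
    using cf_expansion.x_gt_1[OF assms(1), of n] cf_expansion.x_gt_1[OF assms(2), of k]
    by (simp_all add: divide_less_eq)
  from habs_diff_less[OF this] show ?case by simp
next
  case (Suc L)
  have q: "real CARD('a) > 1" by (rule card_field_gt_1)
  have "habs (1 / x (Suc n) - 1 / y (Suc k)) \<le> habs (x (Suc n) - y (Suc k)) / real CARD('a) ^ 2"
    using cf_expansion.x_gt_1[OF assms(1)] cf_expansion.x_gt_1[OF assms(2)]
    by (rule habs_inverse_diff_le)
  also have "x (Suc n) - y (Suc k) = 1 / x (Suc (Suc n)) - 1 / y (Suc (Suc k))"
    using cf_expansion.x_Suc[OF assms(1), of "Suc n"] cf_expansion.x_Suc[OF assms(2), of "Suc k"]
      Suc.prems[of 0] by simp
  also have "habs \<dots> / real CARD('a) ^ 2 \<le> (1 / real CARD('a) ^ L) / real CARD('a) ^ 2"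
    using Suc.prems[of "Suc i" for i] by (intro divide_right_mono Suc.IH) auto
  also have "\<dots> \<le> 1 / real CARD('a) ^ Suc L"
    using q by (simp add: divide_le_eq power2_eq_square)
  finally show ?case .
qed

text \<open>\<open>- t\<close> is the preimage of infinity under the convergent matrix, so |z + t|
  governs the distance of the images. In the quotient the squared denominator cancels, leaving one
  factor for the future and one for the past.\<close>

lemma (in cf_expansion) homog_approximation:
  fixes n y z
  defines "\<beta> \<equiv> homog (P (Suc n)) (P n) (Q (Suc n)) (Q n) y"
    and "\<beta>' \<equiv> homog (P (Suc n)) (P n) (Q (Suc n)) (Q n) z"
    and "t \<equiv> Q n / Q (Suc n)"
  assumes y: "habs y > 1" and z: "habs z < 1" "z \<notin> Kfield"
  shows "habs (\<beta> - \<beta>') = 1 / (habs (Q (Suc n)) ^ 2 * habs (z + t))"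
    and "habs (x 0 - \<beta>) / habs (\<beta> - \<beta>') = habs (1 / x (Suc n) - 1 / y) * habs (z + t)"
proof -
  have Qn: "Q (Suc n) \<noteq> 0" by (rule Q_nz)
  have dx: "habs (Q (Suc n) * x (Suc n) + Q n) = habs (Q (Suc n)) * habs (x (Suc n))"
    by (rule denominator_habs)
  have "habs (Q n) < habs (Q (Suc n)) * 1" using Q_less[of n] by simp
  also have "\<dots> < habs (Q (Suc n)) * habs y"
    using y Qn by (intro mult_strict_left_mono) auto
  finally have dy: "habs (Q (Suc n) * y + Q n) = habs (Q (Suc n)) * habs y"
    by (simp add: habs_add_eq_left)
  have "Q (Suc n) * z + Q n = Q (Suc n) * (z + t)" using Qn by (simp add: t_def distrib_left)
  hence dz: "habs (Q (Suc n) * z + Q n) = habs (Q (Suc n)) * habs (z + t)" by simp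
  have y0: "y \<noteq> 0" using y by auto
  have "- t \<in> Kfield"
    by (rule KfieldI[of "- Q n" "Q (Suc n)"]) (auto simp: t_def Qn intro!: Rpoly_minus conv_Rpoly a_Rpoly)
  hence "z \<noteq> - t" using z(2) by auto
  hence zt: "z + t \<noteq> 0" by (simp add: add_eq_0_iff2)
  have nz: "Q (Suc n) * x (Suc n) + Q n \<noteq> 0" "Q (Suc n) * y + Q n \<noteq> 0" "Q (Suc n) * z + Q n \<noteq> 0"
    using Qn x_nz[of n] y0 zt dx dy dz by (metis habs_eq_0_iff mult_eq_0_iff)+
  have det: "habs (P (Suc n) * Q n - P n * Q (Suc n)) = 1"
    by (rule pgl2R_habs_det[OF conv_pgl2R[OF a_Rpoly]])
  have yz: "habs (y - z) = habs y" using y z by (intro habs_diff_eq_left) simp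
  show 1: "habs (\<beta> - \<beta>') = 1 / (habs (Q (Suc n)) ^ 2 * habs (z + t))"
    unfolding \<beta>_def \<beta>'_def homog_diff[OF nz(2,3)] habs_divide habs_mult det dy dz yz
    using y0 by (simp add: power2_eq_square)
  have "habs (x 0 - \<beta>) = habs (x (Suc n) - y) / (habs (Q (Suc n)) * habs (x (Suc n)) * (habs (Q (Suc n)) * habs y))"
    unfolding \<beta>_def x_0_eq[of n] homog_diff[OF nz(1,2)] habs_divide habs_mult det dx dy by simp
  moreover have "1 / x (Suc n) - 1 / y = (y - x (Suc n)) / (x (Suc n) * y)"
    using x_nz[of n] y0 by (simp add: field_simps)
  hence "habs (1 / x (Suc n) - 1 / y) = habs (x (Suc n) - y) / (habs (x (Suc n)) * habs y)"
    by (simp add: habs_minus_commute)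
  ultimately show "habs (x 0 - \<beta>) / habs (\<beta> - \<beta>') = habs (1 / x (Suc n) - 1 / y) * habs (z + t)"
    unfolding 1 using Qn zt by (simp add: power2_eq_square)
qed

lemma habs_1_div_diff_le:
  assumes "habs (x::'a::{field,finite} fls) \<ge> c" "habs y \<ge> c" "c > 0"
  shows "habs (1 / x - 1 / y) \<le> 1 / c"
proof -
  have "habs (1 / x) \<le> 1 / c" "habs (1 / y) \<le> 1 / c"
    using assms by (simp_all add: frac_le)
  thus ?thesis using habs_diff_le[of "1 / x" "1 / y"] by linarith
qed

lemma (in cf_expansion) habs_Q_quotient:
  "habs (Q (Suc n) / Q (Suc (Suc n))) = 1 / habs (a (Suc n))"
  unfolding habs_divide Q_habs_Suc using Q_nz[of n] by simp

text \<open>Two letters whose degrees add up to m, padded by Y. The first letter stays free so that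
  two different ones of the same degree can be used.\<close>

lemma admissible_pattern:
  assumes "(s::'a::{field,finite} fls) \<in> Rpoly" "habs s = real CARD('a) ^ k" "k \<ge> 1" "l \<ge> 1" "k + l = m"
  shows "admissible m (\<lambda>i. if i = 0 then s else if i = 1 then fls_X_inv ^ l else fls_X_inv)"
proof -
  define q where "q = real CARD('a)"
  have q: "q > 1" unfolding q_def by (rule card_field_gt_1)
  have pow: "q ^ i \<le> q ^ j" if "i \<le> j" for i j using that q by (intro power_increasing) auto
  have gt: "q ^ i > 1" if "i \<ge> 1" for i using that q by (intro one_less_power) auto
  have "habs s * habs (fls_X_inv ^ l :: 'a fls) = q ^ m"
    using assms unfolding habs_X_inv_power q_def[symmetric] by (simp flip: power_add)
  moreover have "q ^ l * q ^ 1 \<le> q ^ m" "q ^ 1 * q ^ 1 \<le> q ^ m"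
    unfolding power_add[symmetric] using assms by (intro pow; simp)+
  ultimately show ?thesis
    using assms q gt pow[of k "m - 1"] pow[of l "m - 1"] pow[of 1 "m - 1"]
    by (auto simp: admissible_def simp flip: q_def)
qed

section \<open>Matching words and approximation by the orbit\<close>

context bi_cf
begin

text \<open>Two matches with distant conjugates are needed: if \<open>past k\<close> is too close to \<open>- convQ a n / convQ a (Suc n)\<close>,
  then \<open>|\<beta> - \<beta>\<^sup>\<sigma>|\<close> does not become small, but this cannot happen for both.\<close>

lemma two_good_matches:
  fixes N :: nat
  assumes x: "cf_expansion x a" and m: "m \<ge> 2"
    and univ: "\<And>w. admissible m w \<Longrightarrow> \<exists>j. \<forall>i\<le>m. b (j + int i) = w i"
  shows "\<exists>n\<ge>N. \<exists>i j. habs (past i - past j) \<ge> 1 / real CARD('a) ^ (2 * m) \<and>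
    (\<forall>k\<in>{i, j}. habs (1 / x (Suc n) - 1 / fut k) * habs (past k + convQ a n / convQ a (Suc n)) \<le> 1 / real CARD('a) ^ m)"
proof -
  interpret e: cf_expansion x a by (rule x)
  define q where "q = real CARD('a)"
  have q: "q > 1" unfolding q_def by (rule card_field_gt_1)
  have pow: "q ^ i \<le> q ^ j" if "i \<le> j" for i j using that q by (intro power_increasing) auto
  have X_inv: "habs (fls_X_inv ^ k :: 'a fls) = q ^ k" for k unfolding q_def by (rule habs_X_inv_power)
  have X_inv_1: "habs (fls_X_inv ^ k + 1 :: 'a fls) = q ^ k" if "k \<ge> 1" for k
  proof -
    have "habs (1 :: 'a fls) < habs (fls_X_inv ^ k :: 'a fls)"
      unfolding X_inv habs_1 using that q by (intro one_less_power) auto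
    thus ?thesis unfolding X_inv[symmetric] by (rule habs_add_eq_left)
  qed
  have past_diff: "habs (past (i + 1) - past (j + 1)) \<ge> 1 / q ^ (2 * m)"
    if "b i = fls_X_inv ^ k" "b j = fls_X_inv ^ k + 1" "1 \<le> k" "k \<le> m" for i j k
  proof -
    have "habs (b i - b j) = 1" unfolding that by simp
    hence "habs (past (i + 1) - past (j + 1)) = 1 / (q ^ k * q ^ k)"
      using that X_inv X_inv_1 by (simp only: habs_past_diff)
    also have "\<dots> = 1 / q ^ (2 * k)" by (simp add: mult_2 power_add)
    also have "\<dots> \<ge> 1 / q ^ (2 * m)" using q pow[of "2 * k" "2 * m"] that by (intro divide_left_mono) auto
    finally show ?thesis .
  qed
  show ?thesis
  proof (cases "\<exists>n\<ge>N. q ^ m \<le> habs (a (Suc n)) * habs (a (Suc (Suc n)))")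
    case True
    then obtain n where n: "n \<ge> N" "q ^ m \<le> habs (a (Suc n)) * habs (a (Suc (Suc n)))" by blast
    have a1: "habs (a (Suc i)) > 1" for i using e.x_gt_1[of i] e.habs_a by simp
    obtain d d' where d: "habs (a (Suc n)) = q ^ d" "habs (a (Suc (Suc n))) = q ^ d'"
      using habs_eq_power[OF less_imp_le[OF a1]] unfolding q_def by metis
    have d1: "d \<ge> 1" "d' \<ge> 1" using a1[of n] a1[of "Suc n"] unfolding d by (cases d; cases d'; simp)+
    have "q ^ m \<le> q ^ (d + d')" using n(2) unfolding d by (simp add: power_add)
    hence dd: "m \<le> d + d'" using q by simp
    \<comment> \<open>Splits m as k + l with 1 \<le> k \<le> d and 1 \<le> l \<le> d'; the cap m - 1
      keeps l positive.\<close>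
    define k where "k = min d (m - 1)"
    define l where "l = m - k"
    have kl: "1 \<le> k" "1 \<le> l" "k + l = m" "k \<le> d" "l \<le> d'"
      using d1 dd m unfolding k_def l_def by auto
    have match: "\<exists>i. b i = s \<and> habs (1 / x (Suc (Suc n)) - 1 / fut (i + 1))
        * habs (past (i + 1) + convQ a (Suc n) / convQ a (Suc (Suc n))) \<le> 1 / q ^ m"
      if s: "s \<in> Rpoly" "habs s = q ^ k" for s
    proof -
      from univ[OF admissible_pattern[OF s[unfolded q_def] kl(1,2,3)]] obtain i where
        i: "\<forall>j\<le>m. b (i + int j) = (if j = 0 then s else if j = 1 then fls_X_inv ^ l else fls_X_inv)"
        by blast
      have bi: "b i = s" "b (i + 1) = fls_X_inv ^ l"
        using i[rule_format, of 0] i[rule_format, of 1] m by simp_all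
      \<comment> \<open>The degrees alone suffice here: both inverses have size at most q^-l, and
        both terms of the past factor have size at most q^-k.\<close>
      have "habs (1 / x (Suc (Suc n)) - 1 / fut (i + 1)) \<le> 1 / q ^ l"
        using kl pow[of l d'] q
        by (intro habs_1_div_diff_le) (simp_all only: habs_fut bi X_inv e.habs_a[symmetric] d, simp_all)
      moreover have "habs (past (i + 1) + convQ a (Suc n) / convQ a (Suc (Suc n))) \<le> 1 / q ^ k"
      proof -
        have "habs (past (i + 1)) = 1 / q ^ k" using bi s by (simp add: habs_past)
        moreover have "habs (convQ a (Suc n) / convQ a (Suc (Suc n))) \<le> 1 / q ^ k"
          unfolding e.habs_Q_quotient d using q pow[of k d] kl by (intro divide_left_mono) auto
        ultimately show ?thesis
          using habs_add_le[of "past (i + 1)" "convQ a (Suc n) / convQ a (Suc (Suc n))"] by linarith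
      qed
      ultimately have "habs (1 / x (Suc (Suc n)) - 1 / fut (i + 1))
        * habs (past (i + 1) + convQ a (Suc n) / convQ a (Suc (Suc n))) \<le> 1 / q ^ l * (1 / q ^ k)"
        using q by (intro mult_mono) auto
      also have "\<dots> = 1 / q ^ m" unfolding kl(3)[symmetric] by (simp add: power_add)
      finally show ?thesis using bi by blast
    qed
    \<comment> \<open>The letters Y^k and Y^k + 1 have equal size and differ by 1, as
      \<open>past_diff\<close> requires.\<close>
    from match[OF Rpoly_X_inv_power X_inv] obtain i where
      i: "b i = fls_X_inv ^ k" "habs (1 / x (Suc (Suc n)) - 1 / fut (i + 1))
        * habs (past (i + 1) + convQ a (Suc n) / convQ a (Suc (Suc n))) \<le> 1 / q ^ m" by blast
    from match[OF Rpoly_add[OF Rpoly_X_inv_power Rpoly_1] X_inv_1[OF kl(1)]] obtain j where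
      j: "b j = fls_X_inv ^ k + 1" "habs (1 / x (Suc (Suc n)) - 1 / fut (j + 1))
        * habs (past (j + 1) + convQ a (Suc n) / convQ a (Suc (Suc n))) \<le> 1 / q ^ m" by blast
    show ?thesis unfolding q_def[symmetric]
      by (rule exI[of _ "Suc n"], rule conjI, use n in simp, rule exI[of _ "i + 1"], rule exI[of _ "j + 1"])
        (use past_diff[OF i(1) j(1)] kl i(2) j(2) in \<open>simp del: convQ.simps\<close>)
  next
    case False
    hence less: "habs (a (Suc n)) * habs (a (Suc (Suc n))) < q ^ m" if "n \<ge> N" for n
      using that False not_le by blast
    have a1: "habs (a (Suc i)) > 1" for i using e.x_gt_1[of i] e.habs_a by simp
    have a_le: "habs (a (Suc n)) \<le> q ^ (m - 1)" if "n \<ge> N" for n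
    proof -
      have "habs (a (Suc n)) * q \<le> habs (a (Suc n)) * habs (a (Suc (Suc n)))"
        using habs_gt_1_imp[OF a1] unfolding q_def by (intro mult_left_mono) auto
      also have "\<dots> \<le> q ^ m" using less[OF that] by simp
      also have "\<dots> = q ^ (m - 1) * q" using m by (simp flip: power_Suc2)
      finally show ?thesis using q by simp
    qed
    have match: "\<exists>i. b i = s \<and> habs (1 / x (Suc N) - 1 / fut (i + 1))
        * habs (past (i + 1) + convQ a N / convQ a (Suc N)) \<le> 1 / q ^ m"
      if s: "s \<in> Rpoly" "habs s = q ^ 1" for s
    proof -
      \<comment> \<open>A letter of degree 1 followed by m partial quotients of f: the future factor
        alone then reaches q^-m and the past factor only has to be at most 1.\<close>
      define w where "w i = (case i of 0 \<Rightarrow> s | Suc i \<Rightarrow> a (Suc (N + i)))" for i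
      have "q ^ 1 \<le> q ^ (m - 1)" using m by (intro pow) auto
      moreover have "q * q ^ (m - 1) = q ^ m" using m by (simp flip: power_Suc)
      hence "q * habs (a (Suc N)) \<le> q ^ m"
        using mult_left_mono[OF a_le[of N], of q] q by simp
      ultimately have "admissible m w"
        using s q a1 a_le less e.a_Rpoly
        by (auto simp: admissible_def w_def less_imp_le simp flip: q_def split: nat.splits)
      then obtain i where i: "\<forall>j\<le>m. b (i + int j) = w j" using univ by blast
      hence bi: "b i = s" using i[rule_format, of 0] by (simp add: w_def)
      have "habs (1 / x (Suc N) - 1 / fut (i + int (Suc 0))) \<le> 1 / q ^ m"
        unfolding q_def
      proof (rule cf_expansion_common_prefix[OF x cf_expansion_fut])
        fix j assume "j < m"
        thus "a (Suc (N + j)) = b (i + int (Suc (0 + j)))"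
          using i[rule_format, of "Suc j"] by (simp add: w_def)
      qed
      hence 1: "habs (1 / x (Suc N) - 1 / fut (i + 1)) \<le> 1 / q ^ m" by simp
      have "habs (convQ a N / convQ a (Suc N)) < 1"
        using e.Q_less[of N] e.Q_nz[of N] by (simp add: divide_less_eq)
      hence "habs (past (i + 1) + convQ a N / convQ a (Suc N)) \<le> 1"
        using habs_add_less[OF habs_past_less_1[of "i + 1"]] by (simp add: less_imp_le)
      hence "habs (1 / x (Suc N) - 1 / fut (i + 1))
        * habs (past (i + 1) + convQ a N / convQ a (Suc N)) \<le> 1 / q ^ m * 1"
        using 1 q by (intro mult_mono) auto
      thus ?thesis using bi by auto
    qed
    from match[OF Rpoly_X_inv_power X_inv] obtain i where
      i: "b i = fls_X_inv ^ 1" "habs (1 / x (Suc N) - 1 / fut (i + 1))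
        * habs (past (i + 1) + convQ a N / convQ a (Suc N)) \<le> 1 / q ^ m" by blast
    from match[OF Rpoly_add[OF Rpoly_X_inv_power Rpoly_1] X_inv_1[OF order_refl]] obtain j where
      j: "b j = fls_X_inv ^ 1 + 1" "habs (1 / x (Suc N) - 1 / fut (j + 1))
        * habs (past (j + 1) + convQ a N / convQ a (Suc N)) \<le> 1 / q ^ m" by blast
    show ?thesis unfolding q_def[symmetric]
      by (rule exI[of _ N], rule conjI, simp, rule exI[of _ "i + 1"], rule exI[of _ "j + 1"])
        (use past_diff[OF i(1) j(1)] m i(2) j(2) in \<open>simp del: convQ.simps\<close>)
  qed
qed

text \<open>For each \<epsilon> a single \<beta> is enough: the image of a shift of \<alpha> under a
  convergent matrix of f, taken so late that its distance to its conjugate is below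
  \<epsilon>.\<close>

lemma calpha_upper_bound:
  assumes f: "f \<notin> Kfield" and m: "m \<ge> 2" and conj: "Kconj (fut 0) (past 0)"
    and univ: "\<And>w. admissible m w \<Longrightarrow> \<exists>j. \<forall>i\<le>m. b (j + int i) = w i"
  shows "calpha (fut 0) f \<le> ereal (1 / real CARD('a) ^ m)"
  unfolding calpha_def
proof (rule SUP_least)
  fix \<epsilon> :: real assume "\<epsilon> \<in> {0<..}"
  hence \<epsilon>: "\<epsilon> > 0" by simp
  obtain x a where x: "cf_expansion x a" "x 0 = f" using cf_expansion_exists[OF f] by blast
  interpret e: cf_expansion x a by (rule x)
  define \<delta> where "\<delta> = 1 / real CARD('a) ^ (2 * m)"
  have \<delta>: "\<delta> > 0" by (simp add: \<delta>_def)
  \<comment> \<open>A denominator above both 1 and 1/(\<delta> \<epsilon>) has square above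
    1/(\<delta> \<epsilon>), the size that \<open>approx(1)\<close> calls for.\<close>
  obtain N where N: "\<forall>n\<ge>N. habs (e.Q (Suc n)) > max 1 (1 / (\<delta> * \<epsilon>))" using e.Q_large by blast
  from two_good_matches[OF x(1) m univ, of N, folded \<delta>_def] obtain n i j where
    n: "n \<ge> N" and far: "habs (past i - past j) \<ge> \<delta>" and
    match: "\<And>k. k \<in> {i, j} \<Longrightarrow>
      habs (1 / x (Suc n) - 1 / fut k) * habs (past k + e.Q n / e.Q (Suc n)) \<le> 1 / real CARD('a) ^ m"
    by blast
  define t where "t = e.Q n / e.Q (Suc n)"
  have "\<exists>k\<in>{i, j}. habs (past k + t) \<ge> \<delta>"
  proof (rule ccontr)
    assume "\<not> ?thesis"
    hence "habs ((past i + t) - (past j + t)) < \<delta>" by (intro habs_diff_less) auto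
    thus False using far by simp
  qed
  then obtain k where k: "k \<in> {i, j}" "habs (past k + t) \<ge> \<delta>" by blast
  define G where "G = homog (e.P (Suc n)) (e.P n) (e.Q (Suc n)) (e.Q n)"
  have g: "pgl2R (e.P (Suc n)) (e.P n) (e.Q (Suc n)) (e.Q n)"
    by (rule conv_pgl2R) (rule e.a_Rpoly)
  obtain p q r s where h: "pgl2R p q r s" "fut k = homog p q r s (fut 0)" "past k = homog p q r s (past 0)"
    using fut_past_orbit by blast
  have "Kconj (fut k) (past k)" unfolding h(2,3) by (rule Kconj_homog[OF conj h(1)])
  hence qconj: "qconj (G (fut k)) = G (past k)" unfolding G_def by (intro Kconj_qconj Kconj_homog g)
  have Theta: "G (fut k) \<in> Theta (fut 0)"
    unfolding G_def h(2) homog_homog[OF h(1) fut_notin_Kfield] Theta_def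
    using pgl2R_mult[OF g h(1)] by blast
  have y: "habs (fut k) > 1" by (simp add: habs_fut b_gt_1)
  note approx = e.homog_approximation[where n = n, OF y habs_past_less_1 past_notin_Kfield, folded G_def t_def]
  have Q: "habs (e.Q (Suc n)) > 1" "habs (e.Q (Suc n)) > 1 / (\<delta> * \<epsilon>)" using N n by auto
  have "1 / (\<delta> * \<epsilon>) * 1 < habs (e.Q (Suc n)) * habs (e.Q (Suc n))"
    using Q \<delta> \<epsilon> by (intro mult_strict_mono) auto
  hence "1 < habs (e.Q (Suc n)) ^ 2 * \<delta> * \<epsilon>" using \<delta> \<epsilon> by (simp add: field_simps power2_eq_square)
  also have "\<dots> \<le> habs (e.Q (Suc n)) ^ 2 * habs (past k + t) * \<epsilon>"
    using k \<epsilon> by (intro mult_right_mono mult_left_mono) auto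
  finally have *: "1 < habs (e.Q (Suc n)) ^ 2 * habs (past k + t) * \<epsilon>" .
  have less: "habs (G (fut k) - G (past k)) < \<epsilon>"
  proof -
    have "habs (e.Q (Suc n)) ^ 2 * habs (past k + t) > 0"
      by (intro mult_pos_pos zero_less_power) (use Q(1) k(2) \<delta> in linarith)+
    thus ?thesis using * unfolding approx(1) by (simp add: pos_divide_less_eq mult.commute)
  qed
  have le: "habs (f - G (fut k)) / habs (G (fut k) - G (past k)) \<le> 1 / real CARD('a) ^ m"
    using approx(2) match[OF k(1)] unfolding x(2) t_def by simp
  show "(INF \<beta>\<in>{\<beta> \<in> Theta (fut 0). habs (\<beta> - qconj \<beta>) < \<epsilon>}. ereal (habs (f - \<beta>) / habs (\<beta> - qconj \<beta>)))
      \<le> ereal (1 / real CARD('a) ^ m)"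
    by (rule INF_lower2[of "G (fut k)"]) (use Theta less le in \<open>simp_all add: qconj\<close>)
qed

lemma shallow_Theta:
  assumes conj: "Kconj (fut 0) (past 0)" and \<beta>: "\<beta> \<in> Theta (fut 0)"
  shows "shallow m \<beta> (qconj \<beta>)" "\<beta> \<noteq> qconj \<beta>"
proof -
  have sh: "shallow m (fut 0) (past 0)" "shallow m (past 0) (fut 0)"
    using shallow_fut_past shallow_commute by blast+
  have neq: "fut 0 \<noteq> past 0"
    using habs_fut[of 0] b_gt_1[of 0] habs_past_less_1[of 0] by auto
  note K = fut_notin_Kfield[of 0] past_notin_Kfield[of 0]
  show "shallow m \<beta> (qconj \<beta>)"
    by (rule Theta_cases[OF conj \<beta>]) (simp_all add: shallow_homog K sh)
  have inj: "homog p q r s y \<noteq> homog p q r s z"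
    if "pgl2R p q r s" "y \<notin> Kfield" "z \<notin> Kfield" "y \<noteq> z" for p q r s y z
    using homog_adjugate[OF that(1)] that by metis
  show "\<beta> \<noteq> qconj \<beta>"
    by (rule Theta_cases[OF conj \<beta>]) (use inj K neq in metis)+
qed

end

section \<open>The value q^-m is attained and is the maximum of the spectrum\<close>

theorem theorem1p4:
  fixes m :: nat
  assumes "m \<ge> 2"
  shows "\<exists>\<alpha>::('a::{field,finite}) fls. \<alpha> \<in> Kquad \<and>
           ereal (1 / real CARD('a) ^ m) \<in> Sp \<alpha> \<and>
           (\<forall>c\<in>Sp \<alpha>. c \<le> ereal (1 / real CARD('a) ^ m))"
proof -
  obtain b :: "int \<Rightarrow> 'a fls" and l where b: "bi_cf b m" "\<And>n. b (n + int (Suc l)) = b n"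
    "\<And>w. admissible m w \<Longrightarrow> \<exists>j. \<forall>i\<le>m. b (j + int i) = w i"
    using universal_sequence[OF assms] by blast
  interpret bi_cf b m by (rule b)
  have conj: "Kconj (fut 0) (past 0)" by (rule periodic_Kconj[OF b(2)])
  note upper = calpha_upper_bound[OF _ assms conj b(3)]
  \<comment> \<open>Constant partial quotients of degree m + 1, just above m, make the denominators
    of f grow by more than q^m at each step.\<close>
  define a :: "nat \<Rightarrow> 'a fls" where "a = (\<lambda>_. fls_X_inv ^ Suc m)"
  have q: "real CARD('a) > 1" by (rule card_field_gt_1)
  have habs_a: "habs (a i) = real CARD('a) ^ Suc m" for i unfolding a_def by (rule habs_X_inv_power)
  have big: "habs (a i) > real CARD('a) ^ m" for i
    unfolding habs_a using q by (intro power_strict_increasing) auto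
  have "habs (a i) > 1" for i unfolding habs_a using q by (intro one_less_power) auto
  hence "cf_seq a" by (auto simp: cf_seq_def a_def simp del: power_Suc)
  then interpret e: cf_expansion "\<lambda>n. cf (\<lambda>i. a (n + i))" a by (rule cf_expansion_cf)
  define f where "f = cf (\<lambda>i. a (0 + i))"
  have f: "f \<notin> Kfield" unfolding f_def by (rule e.x_notin_Kfield)
  have f_Theta: "f \<notin> Theta (fut 0)"
    using e.shallow_neq[OF big shallow_Theta[OF conj]] unfolding f_def by blast
  have "ereal (1 / real CARD('a) ^ m) \<le> calpha (fut 0) f"
    unfolding calpha_def
  \<comment> \<open>The lower bound holds for every \<beta> at distance below 1 from its conjugate,
    so the term with \<epsilon> = 1 already bounds the supremum from below.\<close>
  proof (rule SUP_upper2[of 1])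
    show "ereal (1 / real CARD('a) ^ m)
        \<le> (INF \<beta>\<in>{\<beta> \<in> Theta (fut 0). habs (\<beta> - qconj \<beta>) < 1}. ereal (habs (f - \<beta>) / habs (\<beta> - qconj \<beta>)))"
    proof (rule INF_greatest)
      fix \<beta> assume "\<beta> \<in> {\<beta> \<in> Theta (fut 0). habs (\<beta> - qconj \<beta>) < 1}"
      hence \<beta>: "\<beta> \<in> Theta (fut 0)" "habs (\<beta> - qconj \<beta>) < 1" by auto
      have "habs (f - \<beta>) \<ge> habs (\<beta> - qconj \<beta>) / real CARD('a) ^ m"
        unfolding f_def by (rule e.shallow_lower_bound[OF big shallow_Theta[OF conj \<beta>(1)] \<beta>(2)])
      thus "ereal (1 / real CARD('a) ^ m) \<le> ereal (habs (f - \<beta>) / habs (\<beta> - qconj \<beta>))"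
        using shallow_Theta(2)[OF conj \<beta>(1)] by (simp add: field_simps)
    qed
  qed simp
  hence "ereal (1 / real CARD('a) ^ m) = calpha (fut 0) f" using upper[OF f] by (rule antisym)
  hence "ereal (1 / real CARD('a) ^ m) \<in> Sp (fut 0)" unfolding Sp_def using f f_Theta by blast
  moreover have "\<forall>c\<in>Sp (fut 0). c \<le> ereal (1 / real CARD('a) ^ m)"
    unfolding Sp_def using upper by blast
  ultimately show ?thesis using Kconj_Kquad[OF conj] by blast
qed

end
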